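(* Let $m\ge3$. The free generators of the algebra $T(V^1)^{\mathcal D_m}$ are counted by the words in the Cayley graph $\Gamma(\mathcal D_m,\{r,s\})$ which reduce to the identity without crossing the identity; that is, for every $d\ge1$, the number of generators of degree $d$ in a homogeneous free generating set of $T(V^1)^{\mathcal D_m}$ equals the number of words of length $d$ in this Cayley graph which reduce to the identity without crossing the identity.
   Context: $\mathcal D_m=\langle s,r\mid s^2=r^m=srsr=e\rangle$ is the dihedral group of order $2m$. $V^1$ is its geometric module: the two-dimensional real simple module on which $r$ acts as rotation by $2\pi/m$ and $s$ as a reflection. $T(V)=\bigoplus_{d\ge0}V^{\otimes d}$ is the tensor algebra with diagonal group action and $T(V)^{G}$ its graded subalgebra of $G$-invariants. It is a known fact that, for a finite group $G$, $T(V)^G$ is a free associative algebra on a set of homogeneous generators (so the number of generators in each degree is well defined). In the Cayley graph $\Gamma(G,S)$ there is a directed edge $g\to gs$ for each $g\in G,s\in S$. A word of length $d$ reduces to $g$ if it is a sequence $(s_1,\dots,s_d)\in S^d$ with $s_1\cdots s_d=g$. It does not cross the identity if no nonempty proper prefix reduces to the identity, i.e. $s_1\cdots s_j\ne e$ for $1\le j<d$. *)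

theory Defs
  imports
    "HOL-Analysis.Analysis"
    "HOL-Analysis.Finite_Function_Topology"
    "HOL-Algebra.Group"
begin

section \<open>Groups given by generators and relators\<close>

text \<open>A group word is a list of signed generators, \<^term>\<open>(x, True)\<close> standing for
  \<open>x\<close> and \<^term>\<open>(x, False)\<close> for \<open>x\<close> inverse.\<close>

inductive pres_eq :: "('x \<times> bool) list set \<Rightarrow> ('x \<times> bool) list \<Rightarrow> ('x \<times> bool) list \<Rightarrow> bool"
  for Rel :: "('x \<times> bool) list set" where
  pres_refl: "pres_eq Rel u u"
| pres_sym: "pres_eq Rel u v \<Longrightarrow> pres_eq Rel v u"
| pres_trans: "pres_eq Rel u v \<Longrightarrow> pres_eq Rel v w \<Longrightarrow> pres_eq Rel u w"
| pres_append: "pres_eq Rel u v \<Longrightarrow> pres_eq Rel u' v' \<Longrightarrow> pres_eq Rel (u @ u') (v @ v')"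
| pres_cancel: "pres_eq Rel [(x, b), (x, \<not> b)] []"
| pres_relator: "w \<in> Rel \<Longrightarrow> pres_eq Rel w []"

definition pres_class :: "('x \<times> bool) list set \<Rightarrow> ('x \<times> bool) list \<Rightarrow> ('x \<times> bool) list set" where
  "pres_class Rel u = {v. pres_eq Rel u v}"

definition presented_group :: "('x \<times> bool) list set \<Rightarrow> ('x \<times> bool) list set monoid" where
  "presented_group Rel =
     \<lparr>carrier = range (pres_class Rel),
      mult = (\<lambda>A B. \<Union>u\<in>A. \<Union>v\<in>B. pres_class Rel (u @ v)),
      one = pres_class Rel []\<rparr>"

lemma pres_class_eq_iff: "pres_class Rel u = pres_class Rel v \<longleftrightarrow> pres_eq Rel u v"
  unfolding pres_class_def by (blast intro: pres_refl pres_sym pres_trans)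

lemma mult_presented_group [simp]:
  "pres_class Rel u \<otimes>\<^bsub>presented_group Rel\<^esub> pres_class Rel v = pres_class Rel (u @ v)"
proof -
  have "pres_class Rel (u' @ v') = pres_class Rel (u @ v)"
    if "u' \<in> pres_class Rel u" "v' \<in> pres_class Rel v" for u' v'
    using that unfolding pres_class_eq_iff
    by (auto simp: pres_class_def intro: pres_sym pres_append)
  then have "(\<Union>u'\<in>pres_class Rel u. \<Union>v'\<in>pres_class Rel v. pres_class Rel (u' @ v'))
      = (\<Union>u'\<in>pres_class Rel u. \<Union>v'\<in>pres_class Rel v. pres_class Rel (u @ v))"
    by simp
  moreover have "u \<in> pres_class Rel u" "v \<in> pres_class Rel v"
    by (simp_all add: pres_class_def pres_refl)
  ultimately show ?thesis
    unfolding presented_group_def by (simp only: monoid.simps) blast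
qed

lemma one_presented_group: "\<one>\<^bsub>presented_group Rel\<^esub> = pres_class Rel []"
  by (simp add: presented_group_def)

lemma carrier_presented_group: "carrier (presented_group Rel) = range (pres_class Rel)"
  by (simp add: presented_group_def)

lemma pres_class_in_carrier [simp]: "pres_class Rel u \<in> carrier (presented_group Rel)"
  by (auto simp: presented_group_def)

lemma pres_inverse: "pres_eq Rel (rev (map (\<lambda>(x, b). (x, \<not> b)) u) @ u) []"
proof (induction u)
  case Nil
  then show ?case by (simp add: pres_refl)
next
  case (Cons a u)
  obtain x b where a: "a = (x, b)" by fastforce
  have "pres_eq Rel ([(x, \<not> b), (x, b)] @ u) ([] @ u)"
    using pres_cancel[of Rel x "\<not> b"] by (intro pres_append) (auto intro: pres_refl)
  then have "pres_eq Rel (rev (map (\<lambda>(x, b). (x, \<not> b)) u) @ [(x, \<not> b), (x, b)] @ u)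
      (rev (map (\<lambda>(x, b). (x, \<not> b)) u) @ u)"
    by (intro pres_append) (auto intro: pres_refl)
  from pres_trans[OF this Cons.IH] show ?case
    using a by simp
qed

lemma group_presented_group: "group (presented_group Rel)"
proof -
  have rep: "\<exists>u. A = pres_class Rel u" if "A \<in> carrier (presented_group Rel)" for A
    using that by (auto simp: carrier_presented_group)
  show ?thesis
  proof (rule groupI)
    fix A assume "A \<in> carrier (presented_group Rel)"
    then obtain u where u: "A = pres_class Rel u" using rep by blast
    show "\<exists>B\<in>carrier (presented_group Rel). B \<otimes>\<^bsub>presented_group Rel\<^esub> A = \<one>\<^bsub>presented_group Rel\<^esub>"
      using pres_inverse[of Rel u]
      by (intro bexI[of _ "pres_class Rel (rev (map (\<lambda>(x, b). (x, \<not> b)) u))"])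
         (simp_all add: u one_presented_group pres_class_eq_iff)
  next
    fix A assume "A \<in> carrier (presented_group Rel)"
    then obtain u where u: "A = pres_class Rel u" using rep by blast
    show "\<one>\<^bsub>presented_group Rel\<^esub> \<otimes>\<^bsub>presented_group Rel\<^esub> A = A"
      by (simp add: u one_presented_group)
    fix B assume "B \<in> carrier (presented_group Rel)"
    then obtain v where v: "B = pres_class Rel v" using rep by blast
    show "A \<otimes>\<^bsub>presented_group Rel\<^esub> B \<in> carrier (presented_group Rel)"
      by (simp add: u v)
    fix C assume "C \<in> carrier (presented_group Rel)"
    then obtain w where w: "C = pres_class Rel w" using rep by blast
    show "A \<otimes>\<^bsub>presented_group Rel\<^esub> B \<otimes>\<^bsub>presented_group Rel\<^esub> C
        = A \<otimes>\<^bsub>presented_group Rel\<^esub> (B \<otimes>\<^bsub>presented_group Rel\<^esub> C)"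
      by (simp add: u v w)
  qed (simp add: one_presented_group)
qed

text \<open>Universal property of the presentation.\<close>

lemma presented_group_lift:
  fixes f :: "'x \<Rightarrow> 'g"
  assumes H: "group H" and f: "\<And>x. f x \<in> carrier H"
    and rel: "\<And>w. w \<in> Rel \<Longrightarrow>
      foldr (\<lambda>(x, b) y. (if b then f x else inv\<^bsub>H\<^esub> f x) \<otimes>\<^bsub>H\<^esub> y) w \<one>\<^bsub>H\<^esub> = \<one>\<^bsub>H\<^esub>"
  shows "\<exists>h \<in> hom (presented_group Rel) H. \<forall>x. h (pres_class Rel [(x, True)]) = f x"
proof -
  interpret H: group H by fact
  define ev where "ev w = foldr (\<lambda>(x, b) y. (if b then f x else inv\<^bsub>H\<^esub> f x) \<otimes>\<^bsub>H\<^esub> y) w \<one>\<^bsub>H\<^esub>" for w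
  have ev_simps: "ev [] = \<one>\<^bsub>H\<^esub>"
    "\<And>x b w. ev ((x, b) # w) = (if b then f x else inv\<^bsub>H\<^esub> f x) \<otimes>\<^bsub>H\<^esub> ev w"
    by (simp_all add: ev_def)
  have ev_closed: "ev w \<in> carrier H" for w
    by (induction w) (auto simp: ev_simps f)
  have ev_append: "ev (u @ v) = ev u \<otimes>\<^bsub>H\<^esub> ev v" for u v
    by (induction u) (auto simp: ev_simps f ev_closed H.m_assoc)
  have ev_eq: "ev u = ev v" if "pres_eq Rel u v" for u v
    using that
    by induction (auto simp: ev_append ev_simps f rel[folded ev_def])
  define h where "h A = ev (SOME u. u \<in> A)" for A
  have h: "h (pres_class Rel u) = ev u" for u
  proof -
    have "(SOME v. v \<in> pres_class Rel u) \<in> pres_class Rel u"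
      by (rule someI[of _ u]) (simp add: pres_class_def pres_refl)
    then show ?thesis
      unfolding h_def by (metis ev_eq mem_Collect_eq pres_class_def)
  qed
  have "h \<in> hom (presented_group Rel) H"
  proof (rule homI)
    fix A B assume "A \<in> carrier (presented_group Rel)" "B \<in> carrier (presented_group Rel)"
    then obtain u v where "A = pres_class Rel u" "B = pres_class Rel v"
      unfolding carrier_presented_group by blast
    then show "h (A \<otimes>\<^bsub>presented_group Rel\<^esub> B) = h A \<otimes>\<^bsub>H\<^esub> h B"
      by (simp add: h ev_append)
  next
    fix A assume "A \<in> carrier (presented_group Rel)"
    then obtain u where "A = pres_class Rel u"
      unfolding carrier_presented_group by blast
    then show "h A \<in> carrier H"
      by (simp add: h ev_closed)
  qed
  moreover have "\<forall>x. h (pres_class Rel [(x, True)]) = f x"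
    by (simp add: h ev_simps f)
  ultimately show ?thesis by blast
qed


section \<open>The dihedral group and words in its Cayley graph\<close>

datatype dihedral_gen = Sgen | Rgen

type_synonym dihedral_elem = "(dihedral_gen \<times> bool) list set"

definition dihedral_relators :: "nat \<Rightarrow> (dihedral_gen \<times> bool) list set" where
  "dihedral_relators m =
     {[(Sgen, True), (Sgen, True)],
      replicate m (Rgen, True),
      [(Sgen, True), (Rgen, True), (Sgen, True), (Rgen, True)]}"

definition dihedral :: "nat \<Rightarrow> dihedral_elem monoid" where
  "dihedral m = presented_group (dihedral_relators m)"

definition dihedral_s :: "nat \<Rightarrow> dihedral_elem" where
  "dihedral_s m = pres_class (dihedral_relators m) [(Sgen, True)]"

definition dihedral_r :: "nat \<Rightarrow> dihedral_elem" where
  "dihedral_r m = pres_class (dihedral_relators m) [(Rgen, True)]"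

lemma group_dihedral: "group (dihedral m)"
  by (simp add: dihedral_def group_presented_group)

text \<open>A word \<open>[s\<^sub>1, \<dots>, s\<^sub>d]\<close> over \<open>S\<close> labels the walk
  \<open>e \<rightarrow> s\<^sub>1 \<rightarrow> s\<^sub>1 s\<^sub>2 \<rightarrow> \<dots>\<close> in the Cayley graph with edges \<open>g \<rightarrow> g s\<close>.\<close>

definition word_prod :: "('g, 'b) monoid_scheme \<Rightarrow> 'g list \<Rightarrow> 'g" where
  "word_prod G ws = foldr (\<otimes>\<^bsub>G\<^esub>) ws \<one>\<^bsub>G\<^esub>"

definition reduces_to :: "('g, 'b) monoid_scheme \<Rightarrow> 'g list \<Rightarrow> 'g \<Rightarrow> bool" where
  "reduces_to G ws g \<longleftrightarrow> word_prod G ws = g"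

definition crosses_identity :: "('g, 'b) monoid_scheme \<Rightarrow> 'g list \<Rightarrow> bool" where
  "crosses_identity G ws \<longleftrightarrow> (\<exists>j. 1 \<le> j \<and> j < length ws \<and> reduces_to G (take j ws) \<one>\<^bsub>G\<^esub>)"


section \<open>Free associative algebras\<close>

text \<open>Lists under concatenation form the free monoid; hence \<^typ>\<open>'x list \<Rightarrow>\<^sub>0 real\<close>, with the
  convolution product of \<^theory>\<open>HOL-Library.Poly_Mapping\<close>, is the free associative
  unital real algebra on the letters \<^typ>\<open>'x\<close>.\<close>

instantiation list :: (type) monoid_add
begin

definition zero_list :: "'a list" where "zero_list = []"

definition plus_list :: "'a list \<Rightarrow> 'a list \<Rightarrow> 'a list" where "plus_list u v = u @ v"

instance
  by standard (simp_all add: zero_list_def plus_list_def)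

end

lemma lookup_scaleR_poly_mapping [simp]:
  "Poly_Mapping.lookup (c *\<^sub>R p) k = c *\<^sub>R Poly_Mapping.lookup p k"
proof -
  have "finite {i. c *\<^sub>R Poly_Mapping.lookup p i \<noteq> 0}"
    by (rule finite_subset[OF _ finite_lookup[of p]]) auto
  then show ?thesis
    by (simp add: scaleR_poly_mapping_def)
qed

lemma poly_mapping_sum_single:
  "p = (\<Sum>k\<in>Poly_Mapping.keys p. Poly_Mapping.single k (Poly_Mapping.lookup p k))"
  by (rule poly_mapping_eqI)
     (auto simp: lookup_sum lookup_single when_def in_keys_iff)

lemma scaleR_single: "c *\<^sub>R Poly_Mapping.single k a = Poly_Mapping.single k (c *\<^sub>R a)"
  by (rule poly_mapping_eqI) (simp add: lookup_single when_def)

instance poly_mapping :: (monoid_add, real_algebra_1) real_algebra_1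
proof
  fix c :: real and p q :: "'a \<Rightarrow>\<^sub>0 'b"
  define S where "S r k = Poly_Mapping.single k (Poly_Mapping.lookup r k)" for r :: "'a \<Rightarrow>\<^sub>0 'b" and k
  define P where "P = Poly_Mapping.keys p"
  define Q where "Q = Poly_Mapping.keys q"
  have p: "p = sum (S p) P" and q: "q = sum (S q) Q"
    unfolding S_def P_def Q_def by (rule poly_mapping_sum_single)+
  have left: "c *\<^sub>R S p k * S q l = c *\<^sub>R (S p k * S q l)"
    and right: "S p k * c *\<^sub>R S q l = c *\<^sub>R (S p k * S q l)" for k l
    by (simp_all add: S_def scaleR_single mult_single)
  have "c *\<^sub>R sum (S p) P * sum (S q) Q = c *\<^sub>R (sum (S p) P * sum (S q) Q)"
    by (simp only: scaleR_sum_right sum_product left)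
  then show "c *\<^sub>R p * q = c *\<^sub>R (p * q)"
    by (simp only: p[symmetric] q[symmetric])
  have "sum (S p) P * c *\<^sub>R sum (S q) Q = c *\<^sub>R (sum (S p) P * sum (S q) Q)"
    by (simp only: scaleR_sum_right sum_product right)
  then show "p * c *\<^sub>R q = c *\<^sub>R (p * q)"
    by (simp only: p[symmetric] q[symmetric])
qed

text \<open>The unique unital algebra homomorphism extending \<open>\<phi>\<close>.\<close>

definition free_eval :: "('x \<Rightarrow> 'a::real_algebra_1) \<Rightarrow> ('x list \<Rightarrow>\<^sub>0 real) \<Rightarrow> 'a" where
  "free_eval \<phi> p = (\<Sum>w\<in>Poly_Mapping.keys p. Poly_Mapping.lookup p w *\<^sub>R prod_list (map \<phi> w))"

lemma free_eval_superset:
  assumes "finite K" "Poly_Mapping.keys p \<subseteq> K"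
  shows "free_eval \<phi> p = (\<Sum>w\<in>K. Poly_Mapping.lookup p w *\<^sub>R prod_list (map \<phi> w))"
  unfolding free_eval_def using assms
  by (intro sum.mono_neutral_left) (auto simp: in_keys_iff)

lemma free_eval_add: "free_eval \<phi> (p + q) = free_eval \<phi> p + free_eval \<phi> q"
proof -
  let ?K = "Poly_Mapping.keys p \<union> Poly_Mapping.keys q"
  have "Poly_Mapping.keys (p + q) \<subseteq> ?K" by (rule keys_add)
  then show ?thesis
    by (simp add: free_eval_superset[of ?K] lookup_add scaleR_add_left sum.distrib)
qed

lemma free_eval_scaleR: "free_eval \<phi> (c *\<^sub>R p) = c *\<^sub>R free_eval \<phi> p"
proof -
  have "Poly_Mapping.keys (c *\<^sub>R p) \<subseteq> Poly_Mapping.keys p"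
    by (auto simp: in_keys_iff)
  then show ?thesis
    by (simp add: free_eval_superset[of "Poly_Mapping.keys p"] scaleR_sum_right)
qed

lemma linear_free_eval: "linear (free_eval \<phi>)"
  by (rule linearI) (simp_all add: free_eval_add free_eval_scaleR)

lemma free_eval_single: "free_eval \<phi> (Poly_Mapping.single w c) = c *\<^sub>R prod_list (map \<phi> w)"
  by (simp add: free_eval_def)

lemma free_eval_generator [simp]: "free_eval \<phi> (Poly_Mapping.single [x] 1) = \<phi> x"
  by (simp add: free_eval_single)

lemma free_eval_one [simp]: "free_eval \<phi> 1 = 1"
  by (simp add: free_eval_single zero_list_def flip: single_one)

lemma free_eval_mult: "free_eval \<phi> (p * q) = free_eval \<phi> p * free_eval \<phi> q"
proof -
  have "free_eval \<phi> (p * q) = (\<Sum>u\<in>Poly_Mapping.keys p. \<Sum>v\<in>Poly_Mapping.keys q.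
      free_eval \<phi> (Poly_Mapping.single u (Poly_Mapping.lookup p u)
                 * Poly_Mapping.single v (Poly_Mapping.lookup q v)))"
    by (subst poly_mapping_sum_single[of p], subst poly_mapping_sum_single[of q])
       (simp add: sum_product linear_sum[OF linear_free_eval])
  also have "\<dots> = free_eval \<phi> p * free_eval \<phi> q"
    by (simp only: mult_single free_eval_single plus_list_def free_eval_def[of _ p] free_eval_def[of _ q]
        sum_product map_append prod_list.append mult_scaleR_left mult_scaleR_right scaleR_scaleR)
       (simp add: mult.commute)
  finally show ?thesis .
qed

text \<open>\<open>X\<close> freely generates the subalgebra \<open>A\<close>: the canonical homomorphism from the free algebra
  on the symbols \<open>X\<close>, sending each symbol to itself, is an isomorphism onto \<open>A\<close>.\<close>

definition free_generating_set :: "'a::real_algebra_1 set \<Rightarrow> 'a set \<Rightarrow> bool" where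
  "free_generating_set X A \<longleftrightarrow>
     bij_betw (free_eval (\<lambda>x. x)) {p. Poly_Mapping.keys p \<subseteq> lists X} A"


section \<open>The tensor algebra and its invariants\<close>

text \<open>With the standard basis of \<^typ>\<open>real ^ 'n\<close>, the tensor power of degree \<open>d\<close> has the words
  of length \<open>d\<close> over \<^typ>\<open>'n\<close> as a basis, and the tensor product of basis words is
  concatenation. So the tensor algebra of \<^typ>\<open>real ^ 'n\<close> is \<^typ>\<open>'n list \<Rightarrow>\<^sub>0 real\<close>.\<close>

type_synonym 'n tensor_algebra = "'n list \<Rightarrow>\<^sub>0 real"

definition tensor_power :: "nat \<Rightarrow> 'n tensor_algebra set" where
  "tensor_power d = {p. \<forall>w\<in>Poly_Mapping.keys p. length w = d}"

definition tensor_vec :: "real ^ 'n::finite \<Rightarrow> 'n tensor_algebra" where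
  "tensor_vec v = (\<Sum>i\<in>UNIV. Poly_Mapping.single [i] (v $ i))"

text \<open>The diagonal action: the algebra endomorphism induced by the linear map \<open>A\<close>; see
  \<open>tensor_act_pure\<close> below.\<close>

definition tensor_act :: "real ^ 'n ^ 'n \<Rightarrow> 'n::finite tensor_algebra \<Rightarrow> 'n tensor_algebra" where
  "tensor_act A = free_eval (\<lambda>j. tensor_vec (A *v axis j 1))"

lemma linear_tensor_vec: "linear tensor_vec"
  by (rule linearI)
     (simp_all add: tensor_vec_def single_add sum.distrib scaleR_sum_right scaleR_single)

lemma tensor_act_tensor_vec: "tensor_act A (tensor_vec v) = tensor_vec (A *v v)"
proof -
  have "tensor_act A (tensor_vec v) = (\<Sum>i\<in>UNIV. v $ i *\<^sub>R tensor_vec (A *v axis i 1))"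
    unfolding tensor_act_def
    by (subst (2) tensor_vec_def) (simp add: linear_sum[OF linear_free_eval] free_eval_single)
  also have "\<dots> = tensor_vec (A *v (\<Sum>i\<in>UNIV. v $ i *\<^sub>R axis i 1))"
    by (simp add: linear_sum[OF linear_tensor_vec] linear_cmul[OF linear_tensor_vec]
        linear_sum[OF matrix_vector_mul_linear] linear_cmul[OF matrix_vector_mul_linear])
  also have "(\<Sum>i\<in>UNIV. v $ i *\<^sub>R axis i 1) = v"
    by (simp add: basis_expansion flip: scalar_mult_eq_scaleR)
  finally show ?thesis .
qed

lemma tensor_act_pure:
  "tensor_act A (prod_list (map tensor_vec vs)) = prod_list (map (\<lambda>v. tensor_vec (A *v v)) vs)"
proof (induction vs)
  case Nil
  then show ?case by (simp add: tensor_act_def)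
next
  case (Cons v vs)
  then show ?case
    using tensor_act_tensor_vec[of A v] by (simp add: tensor_act_def free_eval_mult)
qed

definition tensor_invariants ::
  "('g, 'b) monoid_scheme \<Rightarrow> ('g \<Rightarrow> real ^ 'n ^ 'n) \<Rightarrow> 'n::finite tensor_algebra set" where
  "tensor_invariants G \<rho> = {p. \<forall>g\<in>carrier G. tensor_act (\<rho> g) p = p}"

definition homogeneous_free_generating_set ::
  "'n tensor_algebra set \<Rightarrow> 'n tensor_algebra set \<Rightarrow> bool" where
  "homogeneous_free_generating_set X A \<longleftrightarrow>
     free_generating_set X A \<and> X \<subseteq> (\<Union>d. tensor_power d)"


section \<open>The geometric module of the dihedral group\<close>

definition GL :: "(real ^ 'n ^ 'n) monoid" where
  "GL = \<lparr>carrier = {A. invertible A}, mult = (**), one = mat 1\<rparr>"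

lemma group_GL: "group (GL :: (real ^ 'n ^ 'n) monoid)"
proof (rule groupI)
  fix A :: "real ^ 'n ^ 'n" assume "A \<in> carrier GL"
  then obtain B where "A ** B = mat 1" "B ** A = mat 1"
    by (auto simp: GL_def invertible_def)
  then show "\<exists>B\<in>carrier GL. B \<otimes>\<^bsub>GL\<^esub> A = \<one>\<^bsub>GL\<^esub>"
    by (intro bexI[of _ B]) (auto simp: GL_def invertible_def)
qed (simp_all add: GL_def invertible_mult matrix_mul_assoc, simp add: invertible_def exI[of _ "mat 1"])

definition rotation2 :: "real \<Rightarrow> real ^ 2 ^ 2" where
  "rotation2 t = vector [vector [cos t, - sin t], vector [sin t, cos t]]"

definition is_reflection :: "real ^ 'n ^ 'n \<Rightarrow> bool" where
  "is_reflection A \<longleftrightarrow> (\<exists>v. v \<noteq> 0 \<and> (\<forall>x. A *v x = x - (2 * (x \<bullet> v) / (v \<bullet> v)) *\<^sub>R v))"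

definition geometric_module :: "nat \<Rightarrow> (dihedral_elem \<Rightarrow> real ^ 2 ^ 2) \<Rightarrow> bool" where
  "geometric_module m \<rho> \<longleftrightarrow>
     \<rho> \<in> hom (dihedral m) GL \<and>
     \<rho> (dihedral_r m) = rotation2 (2 * pi / real m) \<and>
     is_reflection (\<rho> (dihedral_s m))"

lemma rotation2_add: "rotation2 a ** rotation2 b = rotation2 (a + b)"
  by (simp add: rotation2_def vec_eq_iff matrix_matrix_mult_def forall_2 sum_2
      cos_add sin_add algebra_simps)

lemma rotation2_0: "rotation2 0 = mat 1"
  by (simp add: rotation2_def vec_eq_iff mat_def forall_2)

lemma geometric_module_exists:
  assumes "m \<ge> 1"
  shows "\<exists>\<rho>. geometric_module m \<rho>"
proof -
  define t where "t = 2 * pi / real m"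
  define S :: "real ^ 2 ^ 2" where "S = vector [vector [1, 0], vector [0, - 1]]"
  define f where "f = (\<lambda>x. case x of Sgen \<Rightarrow> S | Rgen \<Rightarrow> rotation2 t)"
  have SS: "S ** S = mat 1"
    by (simp add: S_def vec_eq_iff matrix_matrix_mult_def mat_def forall_2 sum_2)
  have SRS: "S ** (rotation2 t ** S) = rotation2 (- t)"
    by (simp add: S_def rotation2_def vec_eq_iff matrix_matrix_mult_def forall_2 sum_2)
  have SRSR: "S ** (rotation2 t ** (S ** rotation2 t)) = mat 1"
    using SRS rotation2_add[of "- t" t] by (simp add: matrix_mul_assoc rotation2_0)
  have pow: "foldr (\<lambda>(x, b) y. (if b then f x else inv\<^bsub>GL\<^esub> f x) \<otimes>\<^bsub>GL\<^esub> y) (replicate k (Rgen, True)) \<one>\<^bsub>GL\<^esub>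
      = rotation2 (real k * t)" for k
    by (induction k) (simp_all add: GL_def f_def rotation2_0 rotation2_add algebra_simps)
  have "rotation2 (real m * t) = mat 1"
    using assms by (simp add: t_def rotation2_def vec_eq_iff mat_def forall_2)
  with pow[of m] have R: "foldr (\<lambda>(x, b) y. (if b then f x else inv\<^bsub>GL\<^esub> f x) \<otimes>\<^bsub>GL\<^esub> y)
      (replicate m (Rgen, True)) \<one>\<^bsub>GL\<^esub> = \<one>\<^bsub>GL\<^esub>"
    by (simp add: GL_def)
  have "invertible (f x)" for x
    using SS rotation2_add[of t "- t"] rotation2_add[of "- t" t]
    by (cases x) (auto simp: f_def invertible_def rotation2_0)
  then have "f x \<in> carrier GL" for x
    by (simp add: GL_def)
  moreover have "foldr (\<lambda>(x, b) y. (if b then f x else inv\<^bsub>GL\<^esub> f x) \<otimes>\<^bsub>GL\<^esub> y) w \<one>\<^bsub>GL\<^esub> = \<one>\<^bsub>GL\<^esub>"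
    if "w \<in> dihedral_relators m" for w
    using that R SS SRSR unfolding dihedral_relators_def by (auto simp: GL_def f_def)
  ultimately obtain \<rho> where "\<rho> \<in> hom (dihedral m) GL"
    and \<rho>: "\<And>x. \<rho> (pres_class (dihedral_relators m) [(x, True)]) = f x"
    using presented_group_lift[OF group_GL, of f "dihedral_relators m"]
    unfolding dihedral_def by blast
  moreover have "is_reflection S"
    unfolding is_reflection_def
    by (rule exI[of _ "axis 2 1"])
       (auto simp: S_def vec_eq_iff matrix_vector_mult_def forall_2 sum_2 inner_vec_def axis_def)
  ultimately show ?thesis
    by (auto simp: geometric_module_def dihedral_r_def dihedral_s_def f_def t_def)
qed

end

theory Submission
  imports Defs "HOL-Library.Real_Mod"
begin

text \<open>Let \<open>A\<close> be the algebra of invariants, \<open>A\<^sub>d\<close> its part of degree \<open>d\<close>, and \<open>x\<^sub>k\<close> the number of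
  free generators of degree \<open>k\<close>. Freeness says that the products of words in the generators are
  a basis of \<open>A\<close>; splitting off the first letter of such a word gives
  \<open>dim A\<^sub>d = (\<Sum>k=1..d. x\<^sub>k * dim A\<^bsub>d-k\<^esub>)\<close>. A closed walk from the identity is split at its first
  return: if \<open>b\<^sub>d\<close> counts the words of length \<open>d\<close> that reduce to the identity and \<open>c\<^sub>k\<close> those that
  do not cross it, then \<open>b\<^sub>d = (\<Sum>k=1..d. c\<^sub>k * b\<^bsub>d-k\<^esub>)\<close>. Such a recursion determines \<open>x\<close> from
  \<open>dim A\<close> and \<open>c\<close> from \<open>b\<close> in the same way (\<open>renewal_unique\<close>), so everything reduces to
  \<open>dim A\<^sub>d = b\<^sub>d\<close> for \<open>d \<ge> 1\<close>. Both sides turn out to be the number of sign sequences of length \<open>d\<close>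
  that begin with plus and have a sum divisible by \<open>m\<close> (\<open>half_words\<close>).

  For the invariants, pass to the two complex coordinates of the plane that are eigenvectors of
  all rotations and are interchanged by the given reflection. A real tensor \<open>p\<close> of degree \<open>d\<close> is
  then described by complex coefficients \<open>q\<^sub>w(p)\<close>, one for each sign sequence \<open>w\<close> of length \<open>d\<close>, with
  \<open>q\<^bsub>-w\<^esub>(p)\<close> conjugate to \<open>q\<^sub>w(p)\<close>. The rotation multiplies \<open>q\<^sub>w\<close> by the \<open>m\<close>-th root of unity with
  exponent the sum of \<open>w\<close>, and the reflection exchanges \<open>q\<^sub>w\<close> and \<open>q\<^bsub>-w\<^esub>\<close>. So \<open>p\<close> is invariant exactly
  if \<open>q\<^sub>w(p)\<close> vanishes unless the sum of \<open>w\<close> is divisible by \<open>m\<close>, and \<open>q\<^bsub>-w\<^esub>(p) = q\<^sub>w(p)\<close>, which is then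
  real: one free real parameter for every pair \<open>{w, -w}\<close> (\<open>re_tensor_basis\<close>).

  For the words, record before every step of the walk whether the current group element is a
  rotation (plus) or a reflection (minus). With the representatives \<open>e\<close> and \<open>r\<^sup>-\<^sup>1 s\<close> of the two
  cosets of the rotation subgroup, a step of either kind contributes a factor \<open>r\<close> to the power of
  the sign it starts from (\<open>side_step\<close>). Hence a word whose walk ends among the rotations has the
  product \<open>r\<close> to the power of the sum of its sign sequence, and it is determined by that sequence,
  which can be any sequence beginning with plus (\<open>card_closed_words_eq_half_words\<close>).\<close>

section \<open>Matrices of tensor powers\<close>

text \<open>The matrices of all tensor powers of \<open>f\<close> at once, in the bases of words. Words of different
  lengths belong to different tensor powers, so the entry is \<open>0\<close> there.\<close>

fun kron :: "('a \<Rightarrow> 'b \<Rightarrow> complex) \<Rightarrow> 'a list \<Rightarrow> 'b list \<Rightarrow> complex" where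
  "kron f [] [] = 1"
| "kron f (a # w) (b # u) = f a b * kron f w u"
| "kron f [] (b # u) = 0"
| "kron f (a # w) [] = 0"

lemma kron_length: "length w \<noteq> length u \<Longrightarrow> kron f w u = 0"
  by (induction f w u rule: kron.induct) auto

lemma kron_transpose: "kron f w u = kron (\<lambda>b a. f a b) u w"
  by (induction f w u rule: kron.induct) auto

lemma kron_cnj: "cnj (kron f w u) = kron (\<lambda>a b. cnj (f a b)) w u"
  by (induction f w u rule: kron.induct) auto

lemma kron_map: "kron f (map h w) u = kron (\<lambda>a. f (h a)) w u"
proof (induction w arbitrary: u)
  case Nil
  then show ?case by (cases u) auto
next
  case (Cons a w)
  then show ?case by (cases u) auto
qed

lemma kron_scale_rows:
  "kron (\<lambda>a b. c a * f a b) w u = prod_list (map c w) * kron f w u"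
  by (induction f w u rule: kron.induct) auto

lemma kron_scalar_matrix:
  "kron (\<lambda>a b. if a = b then c else 0) w v = (if w = v then c ^ length w else 0)"
proof (induction w arbitrary: v)
  case Nil
  then show ?case by (cases v) auto
next
  case (Cons a w)
  then show ?case by (cases v) auto
qed

lemma finite_lists_length: "finite {u :: 'b::finite list. length u = n}"
  using finite_lists_length_eq[of "UNIV :: 'b set" n] by simp

lemma sum_lists_Suc:
  "(\<Sum>u | length u = Suc n. F u) = (\<Sum>i\<in>UNIV. \<Sum>u | length u = n. F (i # u :: 'b::finite list))"
proof -
  have "{u :: 'b list. length u = Suc n} = (\<lambda>(i, u). i # u) ` (UNIV \<times> {u. length u = n})"
    by (auto simp: length_Suc_conv)
  moreover have "inj_on (\<lambda>(i, u). i # u) (UNIV \<times> {u :: 'b list. length u = n})"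
    by (auto simp: inj_on_def)
  ultimately show ?thesis
    by (simp add: sum.reindex sum.cartesian_product case_prod_unfold)
qed

text \<open>Functoriality of the tensor power. It yields below both orthogonality relations between words,
  as the tensor powers of the two relations between letters.\<close>

lemma kron_mult:
  assumes "length w = n"
  shows "(\<Sum>u | length u = n. kron f w u * kron g u v)
    = kron (\<lambda>a c. \<Sum>b\<in>UNIV. f a b * g (b :: 'b::finite) c) w v"
  using assms
proof (induction w arbitrary: n v)
  case Nil
  then show ?case by (cases v) auto
next
  case (Cons a w)
  show ?case
  proof (cases v)
    case Nil
    have "kron g u [] = 0" if "length u = n" for u
      using that Cons.prems by (intro kron_length) auto
    with Nil show ?thesis by simp
  next
    case (Cons c v')
    have "(\<Sum>u | length u = n. kron f (a # w) u * kron g u v)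
      = (\<Sum>b\<in>UNIV. \<Sum>u | length u = length w. (f a b * g b c) * (kron f w u * kron g u v'))"
      using \<open>length (a # w) = n\<close> by (auto simp: Cons sum_lists_Suc mult_ac)
    then show ?thesis
      using Cons.IH[OF refl, of v'] by (simp add: Cons sum_distrib_right flip: sum_distrib_left)
  qed
qed

section \<open>Graded pieces of the tensor algebra and the diagonal action\<close>

lemma lookup_letter_mult:
  "Poly_Mapping.lookup (Poly_Mapping.single [i] c * p) u
    = (case u of [] \<Rightarrow> 0 | j # u' \<Rightarrow> if i = j then c * Poly_Mapping.lookup p u' else 0)"
  for p :: "'n tensor_algebra"
proof -
  have "Poly_Mapping.lookup (Poly_Mapping.single [i] c * p) u
    = (\<Sum>k\<in>Poly_Mapping.keys p. if i # k = u then c * Poly_Mapping.lookup p k else 0)"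
    by (subst poly_mapping_sum_single[of p])
       (simp add: sum_distrib_left mult_single lookup_sum lookup_single when_def plus_list_def)
  also have "\<dots> = (case u of [] \<Rightarrow> 0 | j # u' \<Rightarrow> if i = j then c * Poly_Mapping.lookup p u' else 0)"
  proof (cases u)
    case (Cons j u')
    then show ?thesis
      by (cases "i = j") (auto simp: in_keys_iff)
  qed auto
  finally show ?thesis .
qed

lemma lookup_vec_mult:
  "Poly_Mapping.lookup (tensor_vec v * p) u
    = (case u of [] \<Rightarrow> 0 | i # u' \<Rightarrow> v $ i * Poly_Mapping.lookup p u')"
  by (cases u) (simp_all add: tensor_vec_def sum_distrib_right lookup_sum lookup_letter_mult)

lemma linear_eq_on_words:
  fixes f g :: "'n tensor_algebra \<Rightarrow> 'a::real_vector"
  assumes "linear f" "linear g" "\<And>u. f (Poly_Mapping.single u 1) = g (Poly_Mapping.single u 1)"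
  shows "f p = g p"
proof -
  have "p = (\<Sum>u\<in>Poly_Mapping.keys p. Poly_Mapping.lookup p u *\<^sub>R Poly_Mapping.single u 1)"
    by (subst poly_mapping_sum_single[of p]) (simp add: scaleR_single)
  then show ?thesis
    by (metis (mono_tags, lifting) assms linear_sum linear_cmul sum.cong)
qed

lemma subspace_tensor_power: "subspace (tensor_power d)"
  by (rule subspaceI) (auto simp: tensor_power_def in_keys_iff lookup_add)

lemma lookup_tensor_power:
  assumes "p \<in> tensor_power d" "length u \<noteq> d"
  shows "Poly_Mapping.lookup p u = 0"
  using assms not_in_keys_iff_lookup_eq_zero[of u p] by (auto simp: tensor_power_def)

lemma tensor_power_mult:
  assumes "p \<in> tensor_power a" "q \<in> tensor_power b"
  shows "p * q \<in> tensor_power (a + b)"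
  using assms keys_mult[of p q] by (fastforce simp: tensor_power_def plus_list_def)

lemma one_in_tensor_power: "1 \<in> tensor_power 0"
  by (simp add: tensor_power_def zero_list_def)

lemma tensor_vec_in_tensor_power: "tensor_vec v \<in> tensor_power (Suc 0)"
  unfolding tensor_vec_def
  by (intro subspace_sum[OF subspace_tensor_power]) (auto simp: tensor_power_def)

lemma linear_tensor_act: "linear (tensor_act A)"
  by (simp add: tensor_act_def linear_free_eval)

lemma tensor_act_single:
  "tensor_act A (Poly_Mapping.single u 1) = prod_list (map (\<lambda>j. tensor_vec (A *v axis j 1)) u)"
  by (simp add: tensor_act_def free_eval_single)

lemma tensor_act_mult: "tensor_act (A ** B) p = tensor_act A (tensor_act B p)"
proof (rule linear_eq_on_words[of _ "\<lambda>p. tensor_act A (tensor_act B p)"])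
  show "linear (\<lambda>p. tensor_act A (tensor_act B p))"
    using linear_compose[OF linear_tensor_act linear_tensor_act] by (simp add: o_def)
  show "tensor_act (A ** B) (Poly_Mapping.single u 1) = tensor_act A (tensor_act B (Poly_Mapping.single u 1))" for u
    using tensor_act_pure[of A "map (\<lambda>j. B *v axis j 1) u"]
    by (simp add: tensor_act_single o_def matrix_vector_mul_assoc)
qed (rule linear_tensor_act)

lemma tensor_vec_axis: "tensor_vec (axis j 1) = Poly_Mapping.single [j] 1"
  by (rule poly_mapping_eqI)
     (auto simp: tensor_vec_def lookup_sum lookup_single axis_def when_def if_distrib
        sum.delta' cong: if_cong)

lemma tensor_act_id: "tensor_act (mat 1) p = p"
proof (rule linear_eq_on_words[of "tensor_act (mat 1)" "\<lambda>p. p"])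
  show "tensor_act (mat 1) (Poly_Mapping.single u 1) = Poly_Mapping.single u 1" for u :: "'a list"
    unfolding tensor_act_single
    by (induction u)
       (simp_all add: tensor_vec_axis mult_single plus_list_def zero_list_def flip: single_one)
qed (auto intro: linear_tensor_act linear_ident)

lemma tensor_act_in_tensor_power:
  assumes "p \<in> tensor_power d"
  shows "tensor_act A p \<in> tensor_power d"
proof -
  have "prod_list (map (\<lambda>j. tensor_vec (A *v axis j 1)) u) \<in> tensor_power (length u)" for u
    using tensor_power_mult[OF tensor_vec_in_tensor_power]
    by (induction u) (auto simp: one_in_tensor_power)
  then have "prod_list (map (\<lambda>j. tensor_vec (A *v axis j 1)) u) \<in> tensor_power d"
    if "u \<in> Poly_Mapping.keys p" for u
    using that assms by (auto simp: tensor_power_def)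
  then show ?thesis
    unfolding tensor_act_def free_eval_def
    by (intro subspace_sum[OF subspace_tensor_power] subspace_scale[OF subspace_tensor_power])
qed

lemma subspace_tensor_invariants: "subspace (tensor_invariants G \<rho>)"
  by (rule subspaceI)
     (auto simp: tensor_invariants_def linear_0[OF linear_tensor_act] linear_add[OF linear_tensor_act]
        linear_cmul[OF linear_tensor_act])

section \<open>Isotropic coordinates of a tensor\<close>

text \<open>The coordinates \<open>v\<^sub>1 + \<i> v\<^sub>2\<close> and \<open>v\<^sub>1 - \<i> v\<^sub>2\<close> of the complexified plane, up to a phase \<open>\<kappa>\<close>. Rotations
  scale them for every choice of \<open>\<kappa>\<close>; the phase is there to make a given reflection, whose axis is
  arbitrary, interchange them.\<close>

definition iso_form :: "complex \<Rightarrow> bool \<Rightarrow> real ^ 2 \<Rightarrow> complex" where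
  "iso_form \<kappa> b v = (if b then \<kappa> * Complex (v $ 1) (v $ 2) else cnj (\<kappa> * Complex (v $ 1) (v $ 2)))"

definition iso_weight :: "complex \<Rightarrow> bool list \<Rightarrow> 2 list \<Rightarrow> complex" where
  "iso_weight \<kappa> = kron (\<lambda>b i. iso_form \<kappa> b (axis i 1))"

text \<open>The coordinates of a tensor of degree \<open>length w\<close> with respect to tensor products of the isotropic
  coordinates, as a finite Fourier transform on the words of that length.\<close>

definition iso_coef :: "complex \<Rightarrow> bool list \<Rightarrow> 2 tensor_algebra \<Rightarrow> complex" where
  "iso_coef \<kappa> w p = (\<Sum>u | length u = length w. of_real (Poly_Mapping.lookup p u) * iso_weight \<kappa> w u)"

lemma linear_iso_coef: "linear (iso_coef \<kappa> w)"
  by (rule linearI)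
     (simp_all add: iso_coef_def lookup_add ring_distribs sum.distrib sum_distrib_left mult_ac
        scaleR_conv_of_real[where 'a = complex])

lemma iso_form_not: "iso_form \<kappa> (\<not> b) v = cnj (iso_form \<kappa> b v)"
  by (simp add: iso_form_def)

lemma iso_weight_not: "iso_weight \<kappa> (map Not w) u = cnj (iso_weight \<kappa> w u)"
  by (simp add: iso_weight_def kron_map kron_cnj iso_form_not)

lemma iso_coef_not: "iso_coef \<kappa> (map Not w) p = cnj (iso_coef \<kappa> w p)"
  by (simp add: iso_coef_def iso_weight_not)

lemma iso_form_expand:
  "iso_form \<kappa> b v = (\<Sum>i\<in>UNIV. of_real (v $ i) * iso_form \<kappa> b (axis i 1))"
  by (simp add: iso_form_def sum_2 axis_def complex_eq_iff algebra_simps)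

text \<open>On a product of vectors the coefficient is the product of the coordinates of the factors, one
  for each letter. This carries the action of a matrix on the plane over to the coefficients.\<close>

lemma iso_coef_prod_vec:
  "iso_coef \<kappa> w (prod_list (map (\<lambda>j. tensor_vec (F j)) u)) = kron (\<lambda>b j. iso_form \<kappa> b (F j)) w u"
proof (induction u arbitrary: w)
  case Nil
  show ?case
  proof (cases w)
    case Nil
    then show ?thesis by (simp add: iso_coef_def iso_weight_def lookup_one zero_list_def)
  next
    case (Cons b w')
    have "iso_coef \<kappa> w 1 = 0"
      unfolding iso_coef_def using Cons
      by (intro sum.neutral) (auto simp: lookup_one zero_list_def when_def)
    with Cons show ?thesis by simp
  qed
next
  case (Cons j u)
  show ?case
  proof (cases w)
    case Nil
    then show ?thesis by (simp add: iso_coef_def lookup_vec_mult)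
  next
    case w: (Cons b w')
    let ?P = "prod_list (map (\<lambda>j. tensor_vec (F j)) u)"
    have "iso_coef \<kappa> w (tensor_vec (F j) * ?P)
      = (\<Sum>i\<in>UNIV. \<Sum>u' | length u' = length w'. (of_real (F j $ i) * iso_form \<kappa> b (axis i 1)) *
          (of_real (Poly_Mapping.lookup ?P u') * iso_weight \<kappa> w' u'))"
      by (simp add: w iso_coef_def iso_weight_def sum_lists_Suc lookup_vec_mult mult_ac)
    also have "\<dots> = iso_form \<kappa> b (F j) * iso_coef \<kappa> w' ?P"
      by (simp add: iso_form_expand[of \<kappa> b "F j"] iso_coef_def sum_product)
    finally show ?thesis
      by (simp add: w Cons.IH)
  qed
qed

lemma iso_coef_tensor_act_single:
  "iso_coef \<kappa> w (tensor_act A (Poly_Mapping.single u 1)) = kron (\<lambda>b j. iso_form \<kappa> b (A *v axis j 1)) w u"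
  by (simp add: tensor_act_def free_eval_single iso_coef_prod_vec)

lemma iso_coef_single: "iso_coef \<kappa> w (Poly_Mapping.single u 1) = iso_weight \<kappa> w u"
proof (cases "length u = length w")
  case True
  then have "iso_coef \<kappa> w (Poly_Mapping.single u 1) = (\<Sum>u'\<in>{u}. of_real (Poly_Mapping.lookup (Poly_Mapping.single u 1) u') * iso_weight \<kappa> w u')"
    unfolding iso_coef_def
    by (intro sum.mono_neutral_right finite_lists_length) (auto simp: lookup_single when_def)
  then show ?thesis by simp
next
  case False
  then have "iso_coef \<kappa> w (Poly_Mapping.single u 1) = 0"
    unfolding iso_coef_def by (intro sum.neutral) (auto simp: lookup_single when_def)
  with False show ?thesis
    by (simp add: iso_weight_def kron_length)
qed

lemma iso_coef_tensor_act_scale: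
  assumes "\<And>b v. iso_form \<kappa> b (A *v v) = c b * iso_form \<kappa> b v"
  shows "iso_coef \<kappa> w (tensor_act A p) = prod_list (map c w) * iso_coef \<kappa> w p"
proof (rule linear_eq_on_words[of "\<lambda>p. iso_coef \<kappa> w (tensor_act A p)" "\<lambda>p. prod_list (map c w) * iso_coef \<kappa> w p"])
  show "linear (\<lambda>p. iso_coef \<kappa> w (tensor_act A p))"
    using linear_compose[OF linear_tensor_act linear_iso_coef] by (simp add: o_def)
  show "linear (\<lambda>p. prod_list (map c w) * iso_coef \<kappa> w p)"
    using linear_compose[OF linear_iso_coef, of "(*) (prod_list (map c w))"] linear_times by (simp add: o_def)
qed (simp add: iso_coef_tensor_act_single iso_coef_single assms kron_scale_rows iso_weight_def)

lemma iso_coef_tensor_act_swap: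
  assumes "\<And>b v. iso_form \<kappa> b (A *v v) = iso_form \<kappa> (\<not> b) v"
  shows "iso_coef \<kappa> w (tensor_act A p) = iso_coef \<kappa> (map Not w) p"
proof (rule linear_eq_on_words[of "\<lambda>p. iso_coef \<kappa> w (tensor_act A p)"])
  show "linear (\<lambda>p. iso_coef \<kappa> w (tensor_act A p))"
    using linear_compose[OF linear_tensor_act linear_iso_coef] by (simp add: o_def)
qed (auto simp: iso_coef_tensor_act_single iso_coef_single assms iso_weight_def kron_map intro: linear_iso_coef)

lemma iso_form_orthogonal_signs:
  assumes "norm \<kappa> = 1"
  shows "(\<Sum>i\<in>UNIV. iso_form \<kappa> a (axis i 1) * cnj (iso_form \<kappa> b (axis i 1))) = (if a = b then 2 else 0)"
  using assms complex_norm_square[of \<kappa>]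
  by (simp add: iso_form_def sum_2 axis_def cmod_def complex_eq_iff power2_eq_square algebra_simps)

lemma iso_form_orthogonal_axes:
  assumes "norm \<kappa> = 1"
  shows "(\<Sum>b\<in>UNIV. iso_form \<kappa> b (axis i 1) * cnj (iso_form \<kappa> b (axis j 1))) = (if i = j then 2 else 0)"
  using assms exhaust_2[of i] exhaust_2[of j]
  by (auto simp: UNIV_bool iso_form_def axis_def cmod_def complex_eq_iff power2_eq_square algebra_simps)

lemma iso_weight_orthogonal:
  assumes "norm \<kappa> = 1" "length w = d"
  shows "(\<Sum>u | length u = d. iso_weight \<kappa> w u * cnj (iso_weight \<kappa> v u)) = (if w = v then 2 ^ d else 0)"
proof -
  have "(\<Sum>u | length u = d. iso_weight \<kappa> w u * cnj (iso_weight \<kappa> v u))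
    = (\<Sum>u | length u = d. kron (\<lambda>b i. iso_form \<kappa> b (axis i 1)) w u * kron (\<lambda>i b. cnj (iso_form \<kappa> b (axis i 1))) u v)"
    by (simp add: iso_weight_def kron_cnj kron_transpose[of _ v])
  then show ?thesis
    using assms by (auto simp: kron_mult iso_form_orthogonal_signs kron_scalar_matrix)
qed

lemma iso_weight_orthogonal':
  assumes "norm \<kappa> = 1" "length u = d"
  shows "(\<Sum>w | length w = d. iso_weight \<kappa> w u * cnj (iso_weight \<kappa> w v)) = (if u = v then 2 ^ d else 0)"
proof -
  have "(\<Sum>w | length w = d. iso_weight \<kappa> w u * cnj (iso_weight \<kappa> w v))
    = (\<Sum>w | length w = d. kron (\<lambda>i b. iso_form \<kappa> b (axis i 1)) u w * kron (\<lambda>b i. cnj (iso_form \<kappa> b (axis i 1))) w v)"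
    by (simp add: iso_weight_def kron_cnj kron_transpose[of _ _ u])
  then show ?thesis
    using assms by (auto simp: kron_mult iso_form_orthogonal_axes kron_scalar_matrix)
qed

text \<open>Fourier inversion; by it a homogeneous tensor is determined by its coefficients.\<close>

lemma iso_coef_inversion:
  assumes "norm \<kappa> = 1" "length u = d"
  shows "(\<Sum>w | length w = d. iso_coef \<kappa> w p * cnj (iso_weight \<kappa> w u)) = 2 ^ d * of_real (Poly_Mapping.lookup p u)"
proof -
  have "(\<Sum>w | length w = d. iso_coef \<kappa> w p * cnj (iso_weight \<kappa> w u))
    = (\<Sum>w | length w = d. \<Sum>v | length v = d. of_real (Poly_Mapping.lookup p v) * (iso_weight \<kappa> w v * cnj (iso_weight \<kappa> w u)))"
    unfolding iso_coef_def sum_distrib_right by (intro sum.cong refl) (auto simp: mult_ac)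
  also have "\<dots> = (\<Sum>v | length v = d. of_real (Poly_Mapping.lookup p v) * (\<Sum>w | length w = d. iso_weight \<kappa> w v * cnj (iso_weight \<kappa> w u)))"
    by (subst sum.swap) (simp add: sum_distrib_left)
  also have "\<dots> = (\<Sum>v | length v = d. if v = u then of_real (Poly_Mapping.lookup p v) * 2 ^ d else 0)"
    using assms(1) by (intro sum.cong) (auto simp: iso_weight_orthogonal')
  also have "\<dots> = 2 ^ d * of_real (Poly_Mapping.lookup p u)"
    using assms(2) by (subst sum.delta) (auto simp: finite_lists_length)
  finally show ?thesis .
qed

lemma tensor_power_eqI:
  assumes "norm \<kappa> = 1" "p \<in> tensor_power d" "q \<in> tensor_power d"
    and "\<And>w. length w = d \<Longrightarrow> iso_coef \<kappa> w p = iso_coef \<kappa> w q"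
  shows "p = q"
proof (rule poly_mapping_eqI)
  fix u
  show "Poly_Mapping.lookup p u = Poly_Mapping.lookup q u"
  proof (cases "length u = d")
    case True
    have "2 ^ d * of_real (Poly_Mapping.lookup p u) = (2 ^ d * of_real (Poly_Mapping.lookup q u) :: complex)"
      unfolding iso_coef_inversion[OF assms(1) True, symmetric] using assms(4) by (intro sum.cong) auto
    then show ?thesis by simp
  next
    case False
    then show ?thesis using assms(2,3) by (simp add: lookup_tensor_power)
  qed
qed

section \<open>Rotations, reflections and isotropic coordinates\<close>

lemma iso_form_rotation:
  "iso_form \<kappa> b (rotation2 t *v v) = cis (if b then t else - t) * iso_form \<kappa> b v"
  by (simp add: iso_form_def rotation2_def matrix_vector_mult_def sum_2 complex_eq_iff algebra_simps)

text \<open>If the reflection reverses \<open>v\<close>, choose the phase such that the imaginary part of the coordinate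
  is proportional to the inner product with \<open>v\<close> and the real part to that with a vector orthogonal
  to \<open>v\<close>. The reflection then changes the sign of the imaginary part alone.\<close>

lemma reflection_swaps_iso_forms:
  assumes "is_reflection A"
  obtains \<kappa> where "norm \<kappa> = 1" "\<And>b x. iso_form \<kappa> b (A *v x) = iso_form \<kappa> (\<not> b) x"
proof -
  obtain v where v: "v \<noteq> 0" and A: "\<And>x. A *v x = x - (2 * (x \<bullet> v) / (v \<bullet> v)) *\<^sub>R v"
    using assms unfolding is_reflection_def by blast
  \<comment> \<open>multiplication by \<open>v\<^sub>2 + \<i> v\<^sub>1\<close> takes \<open>x\<^sub>1 + \<i> x\<^sub>2\<close> to a number with imaginary part \<open>x \<bullet> v\<close>\<close>
  define \<kappa>' where "\<kappa>' = Complex (v $ 2) (v $ 1)"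
  have "\<kappa>' \<noteq> 0"
    using v by (auto simp: \<kappa>'_def vec_eq_iff forall_2 complex_eq_iff)
  have vv: "v \<bullet> v \<noteq> 0" using v by simp
  have "\<kappa>' * Complex ((A *v x) $ 1) ((A *v x) $ 2) = cnj (\<kappa>' * Complex (x $ 1) (x $ 2))" for x
  proof -
    define c where "c = 2 * (x \<bullet> v) / (v \<bullet> v)"
    have c: "c * (v $ 1 * v $ 1 + v $ 2 * v $ 2) = 2 * (x $ 1 * v $ 1 + x $ 2 * v $ 2)"
      using vv by (simp add: c_def inner_vec_def sum_2)
    show ?thesis
      using c unfolding A c_def[symmetric] \<kappa>'_def by (simp add: complex_eq_iff algebra_simps)
  qed
  then have "sgn \<kappa>' * Complex ((A *v x) $ 1) ((A *v x) $ 2) = cnj (sgn \<kappa>' * Complex (x $ 1) (x $ 2))" for x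
    by (simp add: sgn_eq)
  then have "iso_form (sgn \<kappa>') b (A *v x) = iso_form (sgn \<kappa>') (\<not> b) x" for b x
    by (simp add: iso_form_def)
  moreover have "norm (sgn \<kappa>') = 1"
    using \<open>\<kappa>' \<noteq> 0\<close> by (simp add: norm_sgn)
  ultimately show ?thesis using that by blast
qed

text \<open>A rotation acts on the coordinate \<open>z\<close> by a complex factor, a reflection by conjugation; the factor
  would have to be \<open>1\<close> at \<open>z = 1\<close> and \<open>-1\<close> at \<open>z = \<i>\<close>.\<close>

lemma reflection_neq_rotation: "\<not> is_reflection (rotation2 t)"
proof
  assume "is_reflection (rotation2 t)"
  then obtain \<kappa> where \<kappa>: "norm \<kappa> = 1" "\<And>b x. iso_form \<kappa> b (rotation2 t *v x) = iso_form \<kappa> (\<not> b) x"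
    by (rule reflection_swaps_iso_forms) blast
  have *: "cis t * (\<kappa> * z) = cnj (\<kappa> * z)" for z
    using \<kappa>(2)[of True "vector [Re z, Im z]"] unfolding iso_form_rotation
    by (simp add: iso_form_def)
  have "\<kappa> \<noteq> 0" using \<kappa>(1) by auto
  then show False
    using *[of "1 / \<kappa>"] *[of "\<i> / \<kappa>"] by simp
qed

definition height :: "bool list \<Rightarrow> int" where
  "height w = sum_list (map (\<lambda>b. if b then 1 else - 1) w)"

lemma height_simps [simp]: "height [] = 0" "height (b # w) = (if b then 1 else - 1) + height w"
  by (simp_all add: height_def)

lemma height_not: "height (map Not w) = - height w"
  by (induction w) auto

lemma prod_cis_height: "prod_list (map (\<lambda>b. cis (if b then t else - t)) w) = cis (of_int (height w) * t)"
  by (induction w) (auto simp: cis_mult ring_distribs)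

lemma cis_multiple_eq_1_iff:
  assumes "m > 0"
  shows "cis (of_int k * (2 * pi / real m)) = 1 \<longleftrightarrow> int m dvd k"
proof -
  have "cis (of_int k * (2 * pi / real m)) = 1 \<longleftrightarrow> (\<exists>n::int. of_int k = (of_int (int m * n) :: real))"
    using assms by (simp add: cis_eq_1_iff field_simps)
  then show ?thesis by (auto simp: dvd_def simp flip: of_int_mult)
qed

text \<open>Negation of all signs preserves the divisibility condition; for positive length, the condition on
  the first sign selects one sequence from each pair of opposite ones.\<close>

definition half_words :: "nat \<Rightarrow> nat \<Rightarrow> bool list set" where
  "half_words m d = {w. length w = d \<and> hd w \<and> int m dvd height w}"

lemma finite_half_words: "finite (half_words m d)"
  by (rule finite_subset[OF _ finite_lists_length[of d]]) (auto simp: half_words_def)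

lemma half_words_not: "w \<in> half_words m d \<Longrightarrow> d \<ge> 1 \<Longrightarrow> v \<in> half_words m d \<Longrightarrow> w \<noteq> map Not v"
  by (metis (mono_tags, lifting) half_words_def hd_map list.size(3) mem_Collect_eq not_one_le_zero)

text \<open>The real part of the pure tensor attached to \<open>w\<close>. Since \<open>w\<close> and its opposite have conjugate
  weights, it has a nonzero coefficient only at these two words.\<close>

definition re_tensor :: "complex \<Rightarrow> bool list \<Rightarrow> 2 tensor_algebra" where
  "re_tensor \<kappa> w = (\<Sum>u | length u = length w. Poly_Mapping.single u (Re (iso_weight \<kappa> w u)))"

lemma lookup_re_tensor:
  "Poly_Mapping.lookup (re_tensor \<kappa> w) u = (if length u = length w then Re (iso_weight \<kappa> w u) else 0)"
  by (simp add: re_tensor_def lookup_sum lookup_single when_def finite_lists_length sum.delta')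

lemma re_tensor_in_tensor_power: "re_tensor \<kappa> w \<in> tensor_power (length w)"
  by (auto simp: tensor_power_def in_keys_iff lookup_re_tensor split: if_splits)

lemma iso_coef_re_tensor:
  assumes "norm \<kappa> = 1" "length v = length w"
  shows "iso_coef \<kappa> v (re_tensor \<kappa> w) = ((if v = w then 1 else 0) + (if v = map Not w then 1 else 0)) * 2 ^ length w / 2"
proof -
  have re: "of_real (Re z) = (cnj z + cnj (cnj z)) / 2" for z
    by (simp add: complex_eq_iff)
  have "iso_coef \<kappa> v (re_tensor \<kappa> w)
    = (\<Sum>u | length u = length w. (iso_weight \<kappa> v u * cnj (iso_weight \<kappa> w u) + iso_weight \<kappa> v u * cnj (iso_weight \<kappa> (map Not w) u)) / 2)"
    unfolding iso_coef_def using assms(2)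
    by (intro sum.cong) (simp_all add: lookup_re_tensor re iso_weight_not algebra_simps del: complex_cnj_cnj complex_add_cnj)
  also have "\<dots> = ((if v = w then 2 ^ length w else 0) + (if v = map Not w then 2 ^ length w else 0)) / 2"
    using assms by (simp add: iso_weight_orthogonal sum.distrib flip: sum_divide_distrib)
  finally show ?thesis by auto
qed

section \<open>A basis of the invariants of the dihedral group\<close>

locale dihedral_rep =
  fixes m :: nat and \<rho> :: "dihedral_elem \<Rightarrow> real ^ 2 ^ 2"
  assumes m_pos: "m > 0" and geom: "geometric_module m \<rho>"
begin

sublocale group "dihedral m"
  by (rule group_dihedral)

sublocale rep: group_hom "dihedral m" GL \<rho>
  using geom group_GL by (simp add: group_hom_def group_hom_axioms_def geometric_module_def group_dihedral)

abbreviation "R \<equiv> \<rho> (dihedral_r m)"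

abbreviation "S \<equiv> \<rho> (dihedral_s m)"

lemma R_eq: "R = rotation2 (2 * pi / real m)" and S_refl: "is_reflection S"
  using geom by (simp_all add: geometric_module_def)

lemma r_closed: "dihedral_r m \<in> carrier (dihedral m)" and s_closed: "dihedral_s m \<in> carrier (dihedral m)"
  by (simp_all add: dihedral_r_def dihedral_s_def dihedral_def)

definition fixed_by where
  "fixed_by p = {g \<in> carrier (dihedral m). tensor_act (\<rho> g) p = p}"

lemma subgroup_fixed_by: "subgroup (fixed_by p) (dihedral m)"
proof (rule subgroupI)
  have one: "\<rho> \<one>\<^bsub>dihedral m\<^esub> = mat 1"
    using rep.hom_one by (simp add: GL_def)
  then have "\<one>\<^bsub>dihedral m\<^esub> \<in> fixed_by p"
    by (simp add: fixed_by_def tensor_act_id)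
  then show "fixed_by p \<noteq> {}" by blast
  have mult: "\<rho> (a \<otimes>\<^bsub>dihedral m\<^esub> b) = \<rho> a ** \<rho> b"
    if "a \<in> carrier (dihedral m)" "b \<in> carrier (dihedral m)" for a b
    using rep.hom_mult[OF that] by (simp add: GL_def)
  show "inv\<^bsub>dihedral m\<^esub> a \<in> fixed_by p" if "a \<in> fixed_by p" for a
  proof -
    have a: "a \<in> carrier (dihedral m)" "tensor_act (\<rho> a) p = p"
      using that by (auto simp: fixed_by_def)
    have "tensor_act (\<rho> (inv\<^bsub>dihedral m\<^esub> a)) (tensor_act (\<rho> a) p) = p"
      unfolding tensor_act_mult[symmetric] mult[OF inv_closed[OF a(1)] a(1), symmetric]
      by (simp only: l_inv[OF a(1)] one tensor_act_id)
    with a show ?thesis by (simp add: fixed_by_def)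
  qed
  show "a \<otimes>\<^bsub>dihedral m\<^esub> b \<in> fixed_by p" if "a \<in> fixed_by p" "b \<in> fixed_by p" for a b
    using that mult[of a b] by (auto simp: fixed_by_def tensor_act_mult simp del: rep.hom_mult)
qed (auto simp: fixed_by_def)

lemma generated_by_r_s:
  assumes "subgroup H (dihedral m)" "dihedral_r m \<in> H" "dihedral_s m \<in> H"
  shows "carrier (dihedral m) \<subseteq> H"
proof -
  have gen: "pres_class (dihedral_relators m) [(x, True)] \<in> H" for x
    using assms(2,3) by (cases x) (auto simp: dihedral_r_def dihedral_s_def)
  have ginv: "pres_class (dihedral_relators m) [(x, False)] \<in> H" for x
  proof -
    have "pres_class (dihedral_relators m) [(x, False)] \<otimes>\<^bsub>dihedral m\<^esub> pres_class (dihedral_relators m) [(x, True)] = \<one>\<^bsub>dihedral m\<^esub>"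
      using pres_cancel[of "dihedral_relators m" x False]
      by (simp add: dihedral_def one_presented_group pres_class_eq_iff)
    then have "inv\<^bsub>dihedral m\<^esub> (pres_class (dihedral_relators m) [(x, True)]) = pres_class (dihedral_relators m) [(x, False)]"
      by (intro inv_equality) (simp_all add: dihedral_def)
    with subgroup.m_inv_closed[OF assms(1) gen[of x]] show ?thesis by simp
  qed
  have "pres_class (dihedral_relators m) u \<in> H" for u
  proof (induction u)
    case Nil
    show ?case
      using subgroup.one_closed[OF assms(1)] by (simp add: dihedral_def one_presented_group)
  next
    case (Cons a u)
    have "pres_class (dihedral_relators m) [a] \<in> H"
      using gen ginv by (cases a; cases "snd a") auto
    from subgroup.m_closed[OF assms(1) this Cons.IH] show ?case
      by (simp add: dihedral_def)
  qed
  then show ?thesis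
    by (auto simp: dihedral_def carrier_presented_group)
qed

text \<open>The stabilizer of \<open>p\<close> is a subgroup, so it is enough that it contains the two generators.\<close>

lemma tensor_invariants_iff:
  "p \<in> tensor_invariants (dihedral m) \<rho> \<longleftrightarrow> tensor_act R p = p \<and> tensor_act S p = p"
  using generated_by_r_s[OF subgroup_fixed_by[of p]] r_closed s_closed
  by (auto simp: tensor_invariants_def fixed_by_def)

definition \<kappa> where
  "\<kappa> = (SOME \<kappa>. norm \<kappa> = 1 \<and> (\<forall>b x. iso_form \<kappa> b (S *v x) = iso_form \<kappa> (\<not> b) x))"

lemma norm_\<kappa>: "norm \<kappa> = 1" and iso_form_S: "iso_form \<kappa> b (S *v x) = iso_form \<kappa> (\<not> b) x"
proof -
  have "\<exists>\<kappa>. norm \<kappa> = 1 \<and> (\<forall>b x. iso_form \<kappa> b (S *v x) = iso_form \<kappa> (\<not> b) x)"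
    using reflection_swaps_iso_forms[OF S_refl] by metis
  from someI_ex[OF this] show "norm \<kappa> = 1" "iso_form \<kappa> b (S *v x) = iso_form \<kappa> (\<not> b) x"
    unfolding \<kappa>_def by blast+
qed

lemma iso_coef_R: "iso_coef \<kappa> w (tensor_act R p) = cis (of_int (height w) * (2 * pi / real m)) * iso_coef \<kappa> w p"
  using iso_coef_tensor_act_scale[OF iso_form_rotation] by (simp only: R_eq prod_cis_height)

lemma iso_coef_S: "iso_coef \<kappa> w (tensor_act S p) = iso_coef \<kappa> (map Not w) p"
  using iso_form_S by (rule iso_coef_tensor_act_swap)

text \<open>The rotation acts diagonally on the coefficients and the reflection permutes them, so invariance
  can be read off word by word.\<close>

lemma invariant_iff_iso_coef:
  assumes "p \<in> tensor_power d"
  shows "p \<in> tensor_invariants (dihedral m) \<rho> \<longleftrightarrow>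
    (\<forall>w. length w = d \<longrightarrow> (iso_coef \<kappa> w p \<noteq> 0 \<longrightarrow> int m dvd height w) \<and> iso_coef \<kappa> (map Not w) p = iso_coef \<kappa> w p)"
proof -
  have eq_iff: "tensor_act A p = p \<longleftrightarrow> (\<forall>w. length w = d \<longrightarrow> iso_coef \<kappa> w (tensor_act A p) = iso_coef \<kappa> w p)" for A
    using tensor_power_eqI[OF norm_\<kappa> tensor_act_in_tensor_power[OF assms] assms] by metis
  have "cis (of_int (height w) * (2 * pi / real m)) * iso_coef \<kappa> w p = iso_coef \<kappa> w p
    \<longleftrightarrow> (iso_coef \<kappa> w p \<noteq> 0 \<longrightarrow> int m dvd height w)" for w
    using cis_multiple_eq_1_iff[OF m_pos, of "height w"] by auto
  then show ?thesis
    unfolding tensor_invariants_iff eq_iff iso_coef_R iso_coef_S by blast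
qed

lemma re_tensor_invariant:
  assumes "w \<in> half_words m d"
  shows "re_tensor \<kappa> w \<in> tensor_invariants (dihedral m) \<rho> \<inter> tensor_power d"
proof -
  have w: "length w = d" "int m dvd height w"
    using assms by (auto simp: half_words_def)
  have *: "map Not v = map Not w \<longleftrightarrow> v = w" "map Not v = w \<longleftrightarrow> v = map Not w" for v
    by (auto simp: list_eq_iff_nth_eq)
  have "re_tensor \<kappa> w \<in> tensor_power d"
    using re_tensor_in_tensor_power[of \<kappa> w] w by simp
  then show ?thesis
    using w by (auto simp: invariant_iff_iso_coef iso_coef_re_tensor[OF norm_\<kappa>] * height_not)
qed

text \<open>The coefficients at half of the words detect linear relations, because each basis element has
  only one nonzero coefficient there. They also determine an invariant tensor: the coefficients at
  the opposite words are equal to them, and all remaining ones vanish.\<close>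

lemma re_tensor_basis:
  assumes "d \<ge> 1"
  shows inj_re_tensor: "inj_on (re_tensor \<kappa>) (half_words m d)"
    and independent_re_tensor: "independent (re_tensor \<kappa> ` half_words m d)"
    and span_re_tensor: "span (re_tensor \<kappa> ` half_words m d) = tensor_invariants (dihedral m) \<rho> \<inter> tensor_power d"
proof -
  let ?W = "half_words m d"
  have len: "length w = d" if "w \<in> ?W" for w
    using that by (simp add: half_words_def)
  have delta: "iso_coef \<kappa> v (re_tensor \<kappa> w) = (if v = w then 2 ^ d / 2 else 0)" if "v \<in> ?W" "w \<in> ?W" for v w
    using iso_coef_re_tensor[OF norm_\<kappa>, of v w] half_words_not[OF that(1) assms that(2)] len that by auto
  have coef_sum: "iso_coef \<kappa> v (\<Sum>w\<in>?W. f w *\<^sub>R re_tensor \<kappa> w) = of_real (f v) * 2 ^ d / 2" if "v \<in> ?W" for f v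
  proof -
    have "iso_coef \<kappa> v (\<Sum>w\<in>?W. f w *\<^sub>R re_tensor \<kappa> w) = (\<Sum>w\<in>?W. if v = w then of_real (f w) * 2 ^ d / 2 else 0)"
      unfolding linear_sum[OF linear_iso_coef] linear_cmul[OF linear_iso_coef]
      using that by (intro sum.cong) (auto simp: delta scaleR_conv_of_real)
    then show ?thesis using that by (simp add: finite_half_words)
  qed
  show inj: "inj_on (re_tensor \<kappa>) ?W"
  proof (rule inj_onI)
    fix v w assume "v \<in> ?W" "w \<in> ?W" "re_tensor \<kappa> v = re_tensor \<kappa> w"
    then show "v = w" using delta[of v v] delta[of v w] by (simp split: if_splits)
  qed
  show "independent (re_tensor \<kappa> ` ?W)"
  proof (rule independent_if_scalars_zero)
    fix f x assume "(\<Sum>x\<in>re_tensor \<kappa> ` ?W. f x *\<^sub>R x) = 0" "x \<in> re_tensor \<kappa> ` ?W"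
    then obtain v where v: "v \<in> ?W" "x = re_tensor \<kappa> v" and "(\<Sum>w\<in>?W. f (re_tensor \<kappa> w) *\<^sub>R re_tensor \<kappa> w) = 0"
      by (auto simp: sum.reindex[OF inj])
    then show "f x = 0"
      using coef_sum[OF v(1), of "\<lambda>w. f (re_tensor \<kappa> w)"] by (simp add: linear_0[OF linear_iso_coef])
  qed (simp add: finite_half_words)
  have sub: "subspace (tensor_invariants (dihedral m) \<rho> \<inter> tensor_power d)"
    by (intro subspace_inter subspace_tensor_invariants subspace_tensor_power)
  show "span (re_tensor \<kappa> ` ?W) = tensor_invariants (dihedral m) \<rho> \<inter> tensor_power d"
  proof
    show "span (re_tensor \<kappa> ` ?W) \<subseteq> tensor_invariants (dihedral m) \<rho> \<inter> tensor_power d"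
      using re_tensor_invariant by (intro span_minimal sub) blast
    show "tensor_invariants (dihedral m) \<rho> \<inter> tensor_power d \<subseteq> span (re_tensor \<kappa> ` ?W)"
    proof
      fix p assume p: "p \<in> tensor_invariants (dihedral m) \<rho> \<inter> tensor_power d"
      \<comment> \<open>\<open>re_tensor \<kappa> w\<close> has the coefficient \<open>2 ^ d / 2\<close> at \<open>w\<close>\<close>
      define q where "q = (\<Sum>w\<in>?W. (2 * Re (iso_coef \<kappa> w p) / 2 ^ d) *\<^sub>R re_tensor \<kappa> w)"
      have q: "q \<in> tensor_invariants (dihedral m) \<rho> \<inter> tensor_power d"
        unfolding q_def using re_tensor_invariant
        by (intro subspace_sum[OF sub] subspace_scale[OF sub]) blast
      have inv: "int m dvd height w" if "iso_coef \<kappa> w x \<noteq> 0" "length w = d"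
        "x \<in> tensor_invariants (dihedral m) \<rho> \<inter> tensor_power d" for x w
        using that invariant_iff_iso_coef[of x d] by blast
      have inv_not: "iso_coef \<kappa> (map Not w) x = iso_coef \<kappa> w x" if "length w = d"
        "x \<in> tensor_invariants (dihedral m) \<rho> \<inter> tensor_power d" for x w
        using that invariant_iff_iso_coef[of x d] by blast
      have eq: "iso_coef \<kappa> w p = iso_coef \<kappa> w q" if "w \<in> ?W" for w
      proof -
        have "cnj (iso_coef \<kappa> w p) = iso_coef \<kappa> w p"
          using inv_not[OF len[OF that] p] by (simp add: iso_coef_not)
        then have "of_real (Re (iso_coef \<kappa> w p)) = iso_coef \<kappa> w p"
          by (simp add: complex_eq_iff)
        then show ?thesis unfolding q_def coef_sum[OF that] by simp
      qed
      have "p = q"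
      proof (rule tensor_power_eqI[OF norm_\<kappa>])
        fix w :: "bool list" assume w: "length w = d"
        show "iso_coef \<kappa> w p = iso_coef \<kappa> w q"
        proof (cases "int m dvd height w")
          case True
          show ?thesis
          proof (cases "hd w")
            case True
            with w \<open>int m dvd height w\<close> show ?thesis by (intro eq) (simp add: half_words_def)
          next
            case False
            then have "map Not w \<in> ?W"
              using w True assms by (cases "w = []") (auto simp: half_words_def height_not hd_map simp del: height_simps)
            from eq[OF this] show ?thesis
              using inv_not[OF w p] inv_not[OF w q] by simp
          qed
        next
          case False
          then show ?thesis using inv[OF _ w p] inv[OF _ w q] by metis
        qed
      qed (use p q in auto)
      moreover have "q \<in> span (re_tensor \<kappa> ` ?W)"
        unfolding q_def by (simp add: span_sum span_scale span_base)
      ultimately show "p \<in> span (re_tensor \<kappa> ` ?W)" by simp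
    qed
  qed
qed

end

section \<open>Decomposition of closed walks at their first return\<close>

definition closed_words :: "('g, 'b) monoid_scheme \<Rightarrow> 'g set \<Rightarrow> nat \<Rightarrow> 'g list set" where
  "closed_words G S d = {ws \<in> lists S. length ws = d \<and> reduces_to G ws \<one>\<^bsub>G\<^esub>}"

definition first_return_words :: "('g, 'b) monoid_scheme \<Rightarrow> 'g set \<Rightarrow> nat \<Rightarrow> 'g list set" where
  "first_return_words G S d =
    {ws \<in> lists S. length ws = d \<and> reduces_to G ws \<one>\<^bsub>G\<^esub> \<and> \<not> crosses_identity G ws}"

context monoid
begin

lemma word_prod_closed: "set ws \<subseteq> carrier G \<Longrightarrow> word_prod G ws \<in> carrier G"
  by (induction ws) (auto simp: word_prod_def)

lemma word_prod_append:
  "set u \<subseteq> carrier G \<Longrightarrow> set v \<subseteq> carrier G \<Longrightarrow> word_prod G (u @ v) = word_prod G u \<otimes> word_prod G v"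
proof (induction u)
  case Nil
  then show ?case using word_prod_closed[of v] by (simp add: word_prod_def)
next
  case (Cons a u)
  then show ?case
    using word_prod_closed[of u] word_prod_closed[of v] by (simp add: word_prod_def m_assoc)
qed

text \<open>A nonempty closed word is cut at its first return to the identity. The cut is unique because no
  nonempty first-return word is a proper prefix of another one.\<close>

lemma closed_words_decomposition:
  assumes "S \<subseteq> carrier G" "d \<ge> 1"
  shows "bij_betw (\<lambda>(k, u, v). u @ v)
    (SIGMA k:{1..d}. first_return_words G S k \<times> closed_words G S (d - k)) (closed_words G S d)"
proof -
  let ?D = "SIGMA k:{1..d}. first_return_words G S k \<times> closed_words G S (d - k)"
  have prod_append: "word_prod G (u @ v) = word_prod G u \<otimes> word_prod G v"
    if "u \<in> lists S" "v \<in> lists S" for u v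
    using that assms(1) by (intro word_prod_append) auto
  have prefix: "\<not> length u < length u'"
    if "u \<in> first_return_words G S k" "u' \<in> first_return_words G S k'" "u @ v = u' @ v'" "k \<ge> 1" for u u' v v' k k'
  proof
    assume "length u < length u'"
    then have "take (length u) u' = u"
      using that(3) by (metis append_eq_conv_conj append_take_drop_id le_cases length_take min.absorb4 nat_less_le take_append take_take)
    then show False
      using that \<open>length u < length u'\<close> unfolding first_return_words_def crosses_identity_def by auto
  qed
  have "inj_on (\<lambda>(k, u, v). u @ v) ?D"
  proof (rule inj_onI)
    fix x y
    assume xy: "x \<in> ?D" "y \<in> ?D" "(\<lambda>(k, u, v). u @ v) x = (\<lambda>(k, u, v). u @ v) y"
    obtain k u v k' u' v' where [simp]: "x = (k, u, v)" "y = (k', u', v')"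
      by (metis surj_pair)
    have *: "k \<in> {1..d}" "k' \<in> {1..d}" "u \<in> first_return_words G S k" "u' \<in> first_return_words G S k'"
      and eq: "u @ v = u' @ v'"
      using xy by auto
    have "length u = length u'"
      using prefix[OF *(3,4) eq] prefix[OF *(4,3) eq[symmetric]] * by auto
    with eq * show "x = y"
      by (auto simp: first_return_words_def)
  qed
  moreover have "(\<lambda>(k, u, v). u @ v) ` ?D = closed_words G S d"
  proof
    show "(\<lambda>(k, u, v). u @ v) ` ?D \<subseteq> closed_words G S d"
      by (auto simp: first_return_words_def closed_words_def reduces_to_def prod_append[unfolded in_lists_conv_set])
    show "closed_words G S d \<subseteq> (\<lambda>(k, u, v). u @ v) ` ?D"
    proof
      fix w assume w: "w \<in> closed_words G S d"
      define P where "P j \<longleftrightarrow> 1 \<le> j \<and> word_prod G (take j w) = \<one>" for j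
      define k where "k = (LEAST j. P j)"
      have "P d" using w assms(2) by (simp add: P_def closed_words_def reduces_to_def)
      then have k: "P k" "k \<le> d" and least: "\<And>j. j < k \<Longrightarrow> \<not> P j"
        unfolding k_def by (auto intro: LeastI Least_le dest: not_less_Least)
      have lists: "take k w \<in> lists S" "drop k w \<in> lists S"
        using w set_take_subset[of k w] set_drop_subset[of k w] by (auto simp: closed_words_def)
      have "take k w \<in> first_return_words G S k"
        using w k least lists
        by (auto simp: first_return_words_def closed_words_def reduces_to_def crosses_identity_def P_def min_def)
      moreover have "word_prod G (drop k w) \<in> carrier G"
        using lists assms(1) by (intro word_prod_closed) auto
      then have "word_prod G (drop k w) = \<one>"
        using w k(1) prod_append[OF lists] by (simp add: P_def closed_words_def reduces_to_def)
      then have "drop k w \<in> closed_words G S (d - k)"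
        using w lists by (simp add: closed_words_def reduces_to_def)
      ultimately show "w \<in> (\<lambda>(k, u, v). u @ v) ` ?D"
        using k by (intro rev_image_eqI[of "(k, take k w, drop k w)"]) (auto simp: P_def)
    qed
  qed
  ultimately show ?thesis by (simp add: bij_betw_def)
qed

lemma card_closed_words:
  assumes "S \<subseteq> carrier G" "finite S" "d \<ge> 1"
  shows "card (closed_words G S d) =
    (\<Sum>k=1..d. card (first_return_words G S k) * card (closed_words G S (d - k)))"
proof -
  have fin: "finite {ws \<in> lists S. length ws = n \<and> Q ws}" for n Q
    by (rule finite_subset[OF _ finite_lists_length_eq[OF assms(2), of n]]) auto
  show ?thesis
    unfolding bij_betw_same_card[OF closed_words_decomposition[OF assms(1,3)], symmetric]
    by (subst card_SigmaI) (auto simp: card_cartesian_product first_return_words_def closed_words_def intro!: fin)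
qed

lemma closed_words_0: "closed_words G S 0 = {[]}"
  by (auto simp: closed_words_def reduces_to_def word_prod_def)

end

text \<open>Because \<open>a 0 = 1\<close>, the recursion can be solved for its last term.\<close>

lemma renewal_unique:
  fixes a x y :: "nat \<Rightarrow> nat"
  assumes "a 0 = 1"
    and x: "\<And>n. n \<ge> 1 \<Longrightarrow> a n = (\<Sum>k=1..n. x k * a (n - k))"
    and y: "\<And>n. n \<ge> 1 \<Longrightarrow> a n = (\<Sum>k=1..n. y k * a (n - k))"
    and "n \<ge> 1"
  shows "x n = y n"
  using \<open>n \<ge> 1\<close>
proof (induction n rule: less_induct)
  case (less n)
  have split: "(\<Sum>k=1..n. z k * a (n - k)) = (\<Sum>k=1..<n. z k * a (n - k)) + z n" for z
    using sum.last_plus[OF less.prems, of "\<lambda>k. z k * a (n - k)"] assms(1) by simp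
  have "(\<Sum>k=1..<n. x k * a (n - k)) = (\<Sum>k=1..<n. y k * a (n - k))"
    using less.IH by (intro sum.cong) auto
  then show ?case
    using x[OF less.prems] y[OF less.prems] split[of x] split[of y] by simp
qed

section \<open>Words in the Cayley graph as sign sequences\<close>

text \<open>A word is encoded by its letters, \<^term>\<open>True\<close> standing for \<open>r\<close> and \<^term>\<open>False\<close> for \<open>s\<close>. Starting in the
  coset of the rotation subgroup given by \<open>b\<close>, the walk stays in its coset at \<open>r\<close> and leaves it at \<open>s\<close>;
  the coset is recorded before each step.\<close>

fun signs :: "bool \<Rightarrow> bool list \<Rightarrow> bool list" where
  "signs b [] = []"
| "signs b (l # ws) = b # signs (b = l) ws"

fun final_sign :: "bool \<Rightarrow> bool list \<Rightarrow> bool" where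
  "final_sign b [] = b"
| "final_sign b (l # ws) = final_sign (b = l) ws"

lemma length_signs [simp]: "length (signs b ws) = length ws"
  by (induction b ws rule: signs.induct) auto

lemma hd_sign_path: "hd (signs b ws @ [final_sign b ws]) = b"
  by (cases ws) auto

text \<open>A letter tells whether two consecutive signs agree, so the signs including the final one
  determine the word.\<close>

lemma sign_path_inj:
  "signs b ws @ [final_sign b ws] = signs b vs @ [final_sign b vs] \<Longrightarrow> ws = vs"
proof (induction ws arbitrary: b vs)
  case Nil
  then show ?case by (cases vs) auto
next
  case (Cons l ws)
  then obtain l' vs' where vs: "vs = l' # vs'" by (cases vs) auto
  with Cons.prems have eq: "signs (b = l) ws @ [final_sign (b = l) ws] = signs (b = l') vs' @ [final_sign (b = l') vs']"
    by simp
  then have "(b = l) = (b = l')"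
    using hd_sign_path[of "b = l" ws] hd_sign_path[of "b = l'" vs'] by simp
  then have "l = l'" by auto
  with eq Cons.IH[of "b = l" vs'] vs show ?case by simp
qed

lemma sign_path_surj:
  "hd (\<sigma> @ [c]) = b \<Longrightarrow> \<exists>ws. signs b ws = \<sigma> \<and> final_sign b ws = c"
proof (induction \<sigma> arbitrary: b)
  case Nil
  then show ?case by (intro exI[of _ "[]"]) auto
next
  case (Cons a \<sigma>)
  obtain ws where "signs (hd (\<sigma> @ [c])) ws = \<sigma>" "final_sign (hd (\<sigma> @ [c])) ws = c"
    using Cons.IH by blast
  moreover have "(b = (b = hd (\<sigma> @ [c]))) = hd (\<sigma> @ [c])" by auto
  ultimately show ?case
    using Cons.prems by (intro exI[of _ "(b = hd (\<sigma> @ [c])) # ws"]) simp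
qed

lemma bij_betw_signs:
  assumes "d \<ge> 1"
  shows "bij_betw (signs True) {ws. length ws = d \<and> final_sign True ws \<and> int m dvd height (signs True ws)} (half_words m d)"
    (is "bij_betw _ ?L _")
proof -
  have "inj_on (signs True) ?L"
    using sign_path_inj[of True] by (auto simp: inj_on_def)
  moreover have "signs True ` ?L = half_words m d"
  proof
    have "hd (signs True ws)" if "length ws = d" for ws
      using that assms by (cases ws) auto
    then show "signs True ` ?L \<subseteq> half_words m d"
      by (auto simp: half_words_def)
    show "half_words m d \<subseteq> signs True ` ?L"
    proof
      fix \<sigma> assume \<sigma>: "\<sigma> \<in> half_words m d"
      then have "hd (\<sigma> @ [True]) = True" by (cases \<sigma>) (auto simp: half_words_def)
      from sign_path_surj[OF this] obtain ws where ws: "signs True ws = \<sigma>" "final_sign True ws" by auto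
      have "length ws = d" using \<sigma> unfolding ws(1)[symmetric] by (simp add: half_words_def)
      with \<sigma> ws show "\<sigma> \<in> signs True ` ?L"
        by (intro image_eqI[of _ _ ws]) (auto simp: half_words_def)
    qed
  qed
  ultimately show ?thesis by (simp add: bij_betw_def)
qed

context dihedral_rep
begin

abbreviation "r \<equiv> dihedral_r m"

abbreviation "s \<equiv> dihedral_s m"

lemma dihedral_relations:
  "s \<otimes>\<^bsub>dihedral m\<^esub> s = \<one>\<^bsub>dihedral m\<^esub>"
  "r [^]\<^bsub>dihedral m\<^esub> m = \<one>\<^bsub>dihedral m\<^esub>"
  "s \<otimes>\<^bsub>dihedral m\<^esub> r = inv\<^bsub>dihedral m\<^esub> r \<otimes>\<^bsub>dihedral m\<^esub> s"
proof -
  have rel: "pres_class (dihedral_relators m) w = \<one>\<^bsub>dihedral m\<^esub>" if "w \<in> dihedral_relators m" for w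
    using pres_relator[OF that] by (simp add: dihedral_def one_presented_group pres_class_eq_iff)
  have mult: "pres_class (dihedral_relators m) u \<otimes>\<^bsub>dihedral m\<^esub> pres_class (dihedral_relators m) v
      = pres_class (dihedral_relators m) (u @ v)" for u v
    by (simp add: dihedral_def)
  show ss: "s \<otimes>\<^bsub>dihedral m\<^esub> s = \<one>\<^bsub>dihedral m\<^esub>"
    unfolding dihedral_s_def mult by (intro rel) (simp add: dihedral_relators_def)
  have "r [^]\<^bsub>dihedral m\<^esub> k = pres_class (dihedral_relators m) (replicate k (Rgen, True))" for k :: nat
  proof (induction k)
    case 0
    show ?case by (simp add: dihedral_def one_presented_group)
  next
    case (Suc k)
    then show ?case
      by (simp add: dihedral_r_def mult replicate_append_same)
  qed
  then show "r [^]\<^bsub>dihedral m\<^esub> m = \<one>\<^bsub>dihedral m\<^esub>"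
    using rel by (simp add: dihedral_relators_def)
  have "s \<otimes>\<^bsub>dihedral m\<^esub> r \<otimes>\<^bsub>dihedral m\<^esub> (s \<otimes>\<^bsub>dihedral m\<^esub> r) = \<one>\<^bsub>dihedral m\<^esub>"
    unfolding dihedral_s_def dihedral_r_def mult by (intro rel) (simp add: dihedral_relators_def)
  then have "s \<otimes>\<^bsub>dihedral m\<^esub> r = inv\<^bsub>dihedral m\<^esub> (s \<otimes>\<^bsub>dihedral m\<^esub> r)"
    using r_closed s_closed by (intro inv_equality[symmetric]) auto
  also have "\<dots> = inv\<^bsub>dihedral m\<^esub> r \<otimes>\<^bsub>dihedral m\<^esub> inv\<^bsub>dihedral m\<^esub> s"
    by (rule inv_mult_group[OF s_closed r_closed])
  also have "inv\<^bsub>dihedral m\<^esub> s = s"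
    using ss s_closed by (intro inv_equality)
  finally show "s \<otimes>\<^bsub>dihedral m\<^esub> r = inv\<^bsub>dihedral m\<^esub> r \<otimes>\<^bsub>dihedral m\<^esub> s" .
qed

definition letter :: "bool \<Rightarrow> dihedral_elem" where
  "letter l = (if l then r else s)"

text \<open>Representatives of the two cosets of the rotation subgroup. The one for the reflections is
  \<open>r\<^sup>-\<^sup>1 s\<close> and not \<open>s\<close>, which makes the exponent of \<open>r\<close> in \<open>side_step\<close> independent of the letter.\<close>

definition side :: "bool \<Rightarrow> dihedral_elem" where
  "side b = (if b then \<one>\<^bsub>dihedral m\<^esub> else inv\<^bsub>dihedral m\<^esub> r \<otimes>\<^bsub>dihedral m\<^esub> s)"

lemma letter_closed [simp]: "letter l \<in> carrier (dihedral m)"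
  and side_closed [simp]: "side b \<in> carrier (dihedral m)"
  using r_closed s_closed by (auto simp: letter_def side_def)

lemma side_step:
  "side b \<otimes>\<^bsub>dihedral m\<^esub> letter l = r [^]\<^bsub>dihedral m\<^esub> (if b then 1 else - 1 :: int) \<otimes>\<^bsub>dihedral m\<^esub> side (b = l)"
  using r_closed s_closed dihedral_relations(1,3)
  by (cases b; cases l) (simp_all add: side_def letter_def int_pow_neg m_assoc flip: m_assoc[of r])

lemma side_word:
  "side b \<otimes>\<^bsub>dihedral m\<^esub> word_prod (dihedral m) (map letter ws)
    = r [^]\<^bsub>dihedral m\<^esub> height (signs b ws) \<otimes>\<^bsub>dihedral m\<^esub> side (final_sign b ws)"
proof (induction ws arbitrary: b)
  case Nil
  show ?case by (simp add: word_prod_def)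
next
  case (Cons l ws)
  have closed: "word_prod (dihedral m) (map letter ws) \<in> carrier (dihedral m)"
    by (intro word_prod_closed) auto
  have "side b \<otimes>\<^bsub>dihedral m\<^esub> word_prod (dihedral m) (map letter (l # ws))
    = side b \<otimes>\<^bsub>dihedral m\<^esub> letter l \<otimes>\<^bsub>dihedral m\<^esub> word_prod (dihedral m) (map letter ws)"
    using closed by (simp add: word_prod_def m_assoc)
  also have "\<dots> = r [^]\<^bsub>dihedral m\<^esub> (if b then 1 else - 1 :: int) \<otimes>\<^bsub>dihedral m\<^esub>
      (side (b = l) \<otimes>\<^bsub>dihedral m\<^esub> word_prod (dihedral m) (map letter ws))"
    unfolding side_step using closed r_closed by (simp add: m_assoc)
  also have "\<dots> = r [^]\<^bsub>dihedral m\<^esub> height (signs b (l # ws)) \<otimes>\<^bsub>dihedral m\<^esub> side (final_sign b (l # ws))"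
    unfolding Cons.IH signs.simps final_sign.simps height_simps int_pow_mult[OF r_closed]
    using r_closed by (simp add: m_assoc)
  finally show ?case .
qed

text \<open>The representation separates the elements of the presented group that matter here: it shows that
  \<open>r\<close> has order exactly \<open>m\<close> and that \<open>s\<close> is not a power of \<open>r\<close>.\<close>

lemma rep_r_pow: "\<rho> (r [^]\<^bsub>dihedral m\<^esub> (k::int)) = rotation2 (of_int k * (2 * pi / real m))"
proof (induction k rule: int_induct[where k = 0])
  case base
  show ?case using rep.hom_one by (simp add: GL_def rotation2_0)
next
  case (step1 i)
  then show ?case
    using rep.hom_mult[of "r [^]\<^bsub>dihedral m\<^esub> i" r] r_closed
    by (simp add: int_pow_mult GL_def R_eq rotation2_add ring_distribs add_divide_distrib)
next
  case (step2 i)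
  have "\<rho> (r [^]\<^bsub>dihedral m\<^esub> (i - 1)) ** rotation2 (2 * pi / real m) = rotation2 (of_int i * (2 * pi / real m))"
    using rep.hom_mult[of "r [^]\<^bsub>dihedral m\<^esub> (i - 1)" r] r_closed int_pow_mult[OF r_closed, of "i - 1" 1] step2(2)
    by (simp add: GL_def R_eq)
  then have "\<rho> (r [^]\<^bsub>dihedral m\<^esub> (i - 1)) ** (rotation2 (2 * pi / real m) ** rotation2 (- (2 * pi / real m)))
      = rotation2 (of_int i * (2 * pi / real m)) ** rotation2 (- (2 * pi / real m))"
    by (simp add: matrix_mul_assoc)
  then show ?case
    by (simp add: rotation2_add rotation2_0 ring_distribs diff_divide_distrib)
qed

lemma s_not_power: "s \<noteq> r [^]\<^bsub>dihedral m\<^esub> (k::int)"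
  using rep_r_pow[of k] S_refl reflection_neq_rotation by metis

lemma r_pow_eq_one_iff: "r [^]\<^bsub>dihedral m\<^esub> k = \<one>\<^bsub>dihedral m\<^esub> \<longleftrightarrow> int m dvd k"
proof
  assume "r [^]\<^bsub>dihedral m\<^esub> k = \<one>\<^bsub>dihedral m\<^esub>"
  then have "rotation2 (of_int k * (2 * pi / real m)) = rotation2 0"
    using rep_r_pow[of k] rep_r_pow[of 0] by simp
  then have "cis (of_int k * (2 * pi / real m)) = 1"
    by (simp add: rotation2_def vec_eq_iff forall_2 complex_eq_iff)
  then show "int m dvd k"
    using cis_multiple_eq_1_iff[OF m_pos, of k] by blast
next
  assume "int m dvd k"
  then obtain j where "k = int m * j" by (auto simp: dvd_def)
  then show "r [^]\<^bsub>dihedral m\<^esub> k = \<one>\<^bsub>dihedral m\<^esub>"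
    using dihedral_relations(2) int_pow_pow[OF r_closed, of "int m" j] by (simp add: int_pow_int)
qed

lemma word_reduces_to_one_iff:
  "word_prod (dihedral m) (map letter ws) = \<one>\<^bsub>dihedral m\<^esub> \<longleftrightarrow>
    final_sign True ws \<and> int m dvd height (signs True ws)"
proof -
  define k where "k = height (signs True ws)"
  have word: "word_prod (dihedral m) (map letter ws) = r [^]\<^bsub>dihedral m\<^esub> k \<otimes>\<^bsub>dihedral m\<^esub> side (final_sign True ws)"
  proof -
    have "word_prod (dihedral m) (map letter ws) \<in> carrier (dihedral m)"
      by (intro word_prod_closed) auto
    then show ?thesis using side_word[of True ws] by (simp add: side_def[of True] k_def)
  qed
  show ?thesis
  proof (cases "final_sign True ws")
    case True
    then show ?thesis using word r_closed by (simp add: side_def r_pow_eq_one_iff k_def)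
  next
    case False
    have "r [^]\<^bsub>dihedral m\<^esub> k \<otimes>\<^bsub>dihedral m\<^esub> side False = r [^]\<^bsub>dihedral m\<^esub> (k - 1) \<otimes>\<^bsub>dihedral m\<^esub> s"
      using r_closed s_closed int_pow_diff[OF r_closed, of k 1]
      by (simp add: side_def m_assoc del: diff_minus_eq_add)
    moreover have "r [^]\<^bsub>dihedral m\<^esub> (k - 1) \<otimes>\<^bsub>dihedral m\<^esub> s \<noteq> \<one>\<^bsub>dihedral m\<^esub>"
    proof
      assume "r [^]\<^bsub>dihedral m\<^esub> (k - 1) \<otimes>\<^bsub>dihedral m\<^esub> s = \<one>\<^bsub>dihedral m\<^esub>"
      from inv_comm[OF this] have "s = inv\<^bsub>dihedral m\<^esub> (r [^]\<^bsub>dihedral m\<^esub> (k - 1))"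
        using r_closed s_closed inv_equality by simp
      then have "s = r [^]\<^bsub>dihedral m\<^esub> (- (k - 1))"
        using r_closed int_pow_neg by metis
      then show False using s_not_power by blast
    qed
    ultimately show ?thesis using word False by simp
  qed
qed

lemma card_closed_words_eq_half_words:
  assumes "d \<ge> 1"
  shows "card (closed_words (dihedral m) {r, s} d) = card (half_words m d)"
proof -
  let ?L = "{ws. length ws = d \<and> final_sign True ws \<and> int m dvd height (signs True ws)}"
  have "letter True \<noteq> letter False"
    using s_not_power[of 1] r_closed by (simp add: letter_def)
  then have inj: "inj letter"
    by (intro injI) (metis (full_types))
  have "closed_words (dihedral m) {r, s} d = map letter ` ?L"
  proof -
    have "range letter = {r, s}" by (auto simp: letter_def)
    then have "lists {r, s} = range (map letter)"
      by (metis lists_UNIV lists_image)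
    then have "closed_words (dihedral m) {r, s} d
      = {ws \<in> range (map letter). length ws = d \<and> word_prod (dihedral m) ws = \<one>\<^bsub>dihedral m\<^esub>}"
      by (simp only: closed_words_def reduces_to_def)
    also have "\<dots> = map letter ` {ws. length (map letter ws) = d \<and> word_prod (dihedral m) (map letter ws) = \<one>\<^bsub>dihedral m\<^esub>}"
      by blast
    finally show ?thesis
      by (simp only: length_map word_reduces_to_one_iff)
  qed
  moreover have "inj_on (map letter) ?L"
    using inj by (auto intro: inj_on_subset[OF inj_mapI])
  ultimately show ?thesis
    using bij_betw_same_card[OF bij_betw_signs[OF assms, of m]] by (simp add: card_image)
qed

end

section \<open>Homogeneous free generators\<close>

lemma independent_singles: "independent (range (\<lambda>w :: 'x list. Poly_Mapping.single w (1::real)))"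
proof -
  have "u v = 0" if "finite T" "T \<subseteq> range (\<lambda>w :: 'x list. Poly_Mapping.single w (1::real))"
    "(\<Sum>v\<in>T. u v *\<^sub>R v) = 0" "v \<in> T" for T u and v :: "'x list \<Rightarrow>\<^sub>0 real"
  proof -
    from that(2,4) obtain w where w: "v = Poly_Mapping.single w 1" by blast
    have "Poly_Mapping.lookup (\<Sum>v\<in>T. u v *\<^sub>R v) w = (\<Sum>t\<in>T. if t = v then u t else 0)"
      unfolding lookup_sum
    proof (intro sum.cong refl)
      fix t assume "t \<in> T"
      with that(2) obtain w' where "t = Poly_Mapping.single w' 1" by blast
      then show "Poly_Mapping.lookup (u t *\<^sub>R t) w = (if t = v then u t else 0)"
        by (cases "w' = w") (auto simp: w lookup_single dest: arg_cong[of _ _ Poly_Mapping.keys])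
    qed
    with that show ?thesis by simp
  qed
  then show ?thesis
    unfolding independent_explicit_finite_subsets by blast
qed

definition tensor_degree :: "'n tensor_algebra \<Rightarrow> nat" where
  "tensor_degree x = (THE d. x \<in> tensor_power d)"

lemma tensor_degree_eq:
  assumes "x \<in> tensor_power d" "x \<noteq> 0"
  shows "tensor_degree x = d"
  using assms unfolding tensor_degree_def tensor_power_def
  by (intro the_equality) (auto simp flip: keys_eq_empty)

definition words_of_degree :: "'n tensor_algebra set \<Rightarrow> nat \<Rightarrow> 'n tensor_algebra list set" where
  "words_of_degree X d = {w \<in> lists X. sum_list (map tensor_degree w) = d}"

lemma subspace_supported: "subspace {p :: 'a \<Rightarrow>\<^sub>0 real. Poly_Mapping.keys p \<subseteq> K}"
proof (rule subspaceI)
  fix p q :: "'a \<Rightarrow>\<^sub>0 real"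
  assume "p \<in> {p. Poly_Mapping.keys p \<subseteq> K}" "q \<in> {p. Poly_Mapping.keys p \<subseteq> K}"
  then show "p + q \<in> {p. Poly_Mapping.keys p \<subseteq> K}"
    using keys_add[of p q] by blast
qed (auto simp: in_keys_iff)

lemma span_singles_subset:
  "span ((\<lambda>w. Poly_Mapping.single w (1::real)) ` lists X) \<subseteq> {p. Poly_Mapping.keys p \<subseteq> lists X}"
  for X :: "'a set"
  by (rule span_minimal[OF _ subspace_supported]) auto

lemma prod_list_in_tensor_power:
  assumes "\<And>x. x \<in> set w \<Longrightarrow> x \<in> tensor_power (tensor_degree x)"
  shows "prod_list w \<in> tensor_power (sum_list (map tensor_degree w))"
  using assms by (induction w) (auto simp: one_in_tensor_power intro!: tensor_power_mult)

locale free_generators =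
  fixes X A :: "'n tensor_algebra set"
  assumes free: "homogeneous_free_generating_set X A"
begin

abbreviation "F \<equiv> free_eval (\<lambda>x :: 'n tensor_algebra. x)"

abbreviation "P \<equiv> {p :: 'n tensor_algebra list \<Rightarrow>\<^sub>0 real. Poly_Mapping.keys p \<subseteq> lists X}"

lemma inj_F: "inj_on F P" and image_F: "F ` P = A" and homogeneous: "X \<subseteq> (\<Union>d. tensor_power d)"
  using free by (auto simp: homogeneous_free_generating_set_def free_generating_set_def bij_betw_def)

lemma F_single: "F (Poly_Mapping.single w 1) = prod_list w"
  by (simp add: free_eval_single)

lemma generator_nonzero:
  assumes "x \<in> X" shows "x \<noteq> 0"
proof
  assume "x = 0"
  then have "F (Poly_Mapping.single [x] 1) = F 0"
    by (simp add: free_eval_def)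
  then have "Poly_Mapping.single [x] (1::real) = 0"
    using assms by (intro inj_onD[OF inj_F]) auto
  then show False by (metis lookup_single_eq lookup_zero zero_neq_one)
qed

lemma generator_in_tensor_power:
  assumes "x \<in> X" shows "x \<in> tensor_power d \<longleftrightarrow> tensor_degree x = d"
  using homogeneous tensor_degree_eq[OF _ generator_nonzero[OF assms]] assms by blast

text \<open>A generator of degree \<open>0\<close> would be a scalar, hence a multiple of the empty product, and the words
  in the generators would be linearly dependent.\<close>

lemma generator_degree_pos:
  assumes "x \<in> X" shows "tensor_degree x \<ge> 1"
proof (rule ccontr)
  assume "\<not> tensor_degree x \<ge> 1"
  then have "x \<in> tensor_power 0"
    using assms by (simp add: generator_in_tensor_power)
  from lookup_tensor_power[OF this] have x: "x = Poly_Mapping.single [] (Poly_Mapping.lookup x [])"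
    by (intro poly_mapping_eqI) (auto simp: lookup_single when_def)
  have "F (Poly_Mapping.single [x] 1) = F (Poly_Mapping.single [] (Poly_Mapping.lookup x []))"
    by (subst x) (simp add: free_eval_single scaleR_single zero_list_def mult_single plus_list_def flip: single_one)
  then have "Poly_Mapping.single [x] (1::real) = Poly_Mapping.single [] (Poly_Mapping.lookup x [])"
    using assms by (intro inj_onD[OF inj_F]) (auto split: if_splits)
  then have "Poly_Mapping.lookup (Poly_Mapping.single [x] (1::real)) [x]
    = Poly_Mapping.lookup (Poly_Mapping.single [] (Poly_Mapping.lookup x [])) [x]"
    by (rule arg_cong)
  then show False by (simp add: lookup_single)
qed

lemma inj_prod_list: "inj_on prod_list (lists X)"
proof (rule inj_onI)
  fix v w assume "v \<in> lists X" "w \<in> lists X" "prod_list v = prod_list w"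
  then have "Poly_Mapping.single v (1::real) = Poly_Mapping.single w 1"
    by (intro inj_onD[OF inj_F]) (auto simp: F_single)
  then have "Poly_Mapping.keys (Poly_Mapping.single v (1::real)) = Poly_Mapping.keys (Poly_Mapping.single w (1::real))"
    by simp
  then show "v = w" by simp
qed

lemma independent_words: "independent (prod_list ` words_of_degree X d)"
proof -
  let ?s = "(\<lambda>w. Poly_Mapping.single w (1::real)) ` lists X"
  have "independent ?s"
    by (rule independent_mono[OF independent_singles]) auto
  then have "independent (F ` ?s)"
    by (rule linear_independent_injective_image[OF linear_free_eval])
       (rule inj_on_subset[OF inj_F span_singles_subset])
  then show ?thesis
    by (rule independent_mono) (auto simp: image_image F_single words_of_degree_def)
qed

lemma word_in_tensor_power:
  assumes "w \<in> lists X" shows "prod_list w \<in> tensor_power (sum_list (map tensor_degree w))"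
  using assms by (intro prod_list_in_tensor_power) (auto simp: generator_in_tensor_power)

text \<open>An element of \<open>A\<close> is a combination of words; as words are homogeneous, those of another degree
  than \<open>d\<close> cancel if the element has degree \<open>d\<close>, and can be left out.\<close>

lemma span_words: "span (prod_list ` words_of_degree X d) = A \<inter> tensor_power d"
proof
  have "subspace A"
    unfolding image_F[symmetric] by (intro linear_subspace_image[OF linear_free_eval] subspace_supported)
  moreover have "prod_list w \<in> A" if "w \<in> lists X" for w
    unfolding image_F[symmetric] F_single[symmetric] using that by (intro imageI) auto
  ultimately show "span (prod_list ` words_of_degree X d) \<subseteq> A \<inter> tensor_power d"
    using word_in_tensor_power
    by (intro span_minimal subspace_inter subspace_tensor_power) (auto simp: words_of_degree_def)
  show "A \<inter> tensor_power d \<subseteq> span (prod_list ` words_of_degree X d)"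
  proof
    fix p assume p: "p \<in> A \<inter> tensor_power d"
    then obtain q where q: "q \<in> P" "p = F q" using image_F by auto
    let ?K = "Poly_Mapping.keys q \<inter> words_of_degree X d"
    have "p = (\<Sum>w\<in>?K. Poly_Mapping.lookup q w *\<^sub>R prod_list w)"
    proof (rule poly_mapping_eqI)
      fix u
      have off_degree: "Poly_Mapping.lookup (prod_list w) u = 0"
        if "w \<in> Poly_Mapping.keys q" "sum_list (map tensor_degree w) \<noteq> length u" for w
        using word_in_tensor_power[of w] q(1) that by (intro lookup_tensor_power) auto
      show "Poly_Mapping.lookup p u = Poly_Mapping.lookup (\<Sum>w\<in>?K. Poly_Mapping.lookup q w *\<^sub>R prod_list w) u"
      proof (cases "length u = d")
        case True
        then show ?thesis
          using q(1) off_degree unfolding q(2) free_eval_def lookup_sum list.map_ident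
          by (intro sum.mono_neutral_right) (auto simp: words_of_degree_def)
      next
        case False
        have "Poly_Mapping.lookup p u = 0"
          using p False by (auto intro: lookup_tensor_power)
        also have "0 = Poly_Mapping.lookup (\<Sum>w\<in>?K. Poly_Mapping.lookup q w *\<^sub>R prod_list w) u"
          unfolding lookup_sum using off_degree False
          by (intro sum.neutral[symmetric]) (auto simp: words_of_degree_def)
        finally show ?thesis .
      qed
    qed
    also have "\<dots> \<in> span (prod_list ` words_of_degree X d)"
      by (intro span_sum span_scale span_base) auto
    finally show "p \<in> span (prod_list ` words_of_degree X d)" .
  qed
qed

lemma words_of_degree_0: "words_of_degree X 0 = {[]}"
proof -
  have "w = []" if "w \<in> words_of_degree X 0" for w
    using that generator_degree_pos by (cases w) (fastforce simp: words_of_degree_def)+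
  then show ?thesis by (auto simp: words_of_degree_def)
qed

text \<open>A nonempty word splits into its first letter and the rest. Letters have positive degree, which
  makes the rest a word of smaller degree.\<close>

lemma words_of_degree_decomposition:
  "bij_betw (\<lambda>(k, x, w). x # w)
    (SIGMA k:{1..d}. {x \<in> X. x \<in> tensor_power k} \<times> words_of_degree X (d - k)) (words_of_degree X d)"
  if "d \<ge> 1"
proof -
  let ?D = "SIGMA k:{1..d}. {x \<in> X. x \<in> tensor_power k} \<times> words_of_degree X (d - k)"
  have "inj_on (\<lambda>(k, x, w). x # w) ?D"
    by (rule inj_onI) (auto simp: generator_in_tensor_power)
  moreover have "(\<lambda>(k, x, w). x # w) ` ?D = words_of_degree X d"
  proof
    show "(\<lambda>(k, x, w). x # w) ` ?D \<subseteq> words_of_degree X d"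
      by (auto simp: words_of_degree_def generator_in_tensor_power)
    show "words_of_degree X d \<subseteq> (\<lambda>(k, x, w). x # w) ` ?D"
    proof
      fix v assume v: "v \<in> words_of_degree X d"
      with \<open>d \<ge> 1\<close> obtain x w where xw: "v = x # w"
        by (cases v) (auto simp: words_of_degree_def)
      with v generator_degree_pos[of x] show "v \<in> (\<lambda>(k, x, w). x # w) ` ?D"
        by (intro rev_image_eqI[of "(tensor_degree x, x, w)"])
           (auto simp: words_of_degree_def generator_in_tensor_power)
    qed
  qed
  ultimately show ?thesis by (simp add: bij_betw_def)
qed

lemma finite_generators:
  assumes "finite (words_of_degree X d)"
  shows "finite {x \<in> X. x \<in> tensor_power d}"
proof (rule finite_imageD)
  show "finite ((\<lambda>x. [x]) ` {x \<in> X. x \<in> tensor_power d})"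
    by (rule finite_subset[OF _ assms]) (auto simp: words_of_degree_def generator_in_tensor_power)
qed (simp add: inj_on_def)

lemma card_words_of_degree:
  assumes "\<And>n. finite (words_of_degree X n)" "d \<ge> 1"
  shows "card (words_of_degree X d) =
    (\<Sum>k=1..d. card {x \<in> X. x \<in> tensor_power k} * card (words_of_degree X (d - k)))"
  unfolding bij_betw_same_card[OF words_of_degree_decomposition[OF assms(2)], symmetric]
  using finite_generators[OF assms(1)] assms(1)
  by (subst card_SigmaI) (auto simp: card_cartesian_product)

end

section \<open>The count of free generators\<close>

theorem proposition5p8:
  fixes m d :: nat
    and \<rho> :: "dihedral_elem \<Rightarrow> real ^ 2 ^ 2"
    and X :: "2 tensor_algebra set"
  assumes "m \<ge> 3"
    and "geometric_module m \<rho>"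
    and "homogeneous_free_generating_set X (tensor_invariants (dihedral m) \<rho>)"
    and "d \<ge> 1"
  shows "finite {x \<in> X. x \<in> tensor_power d} \<and>
         card {x \<in> X. x \<in> tensor_power d} =
         card {ws \<in> lists {dihedral_r m, dihedral_s m}. length ws = d \<and>
               reduces_to (dihedral m) ws \<one>\<^bsub>dihedral m\<^esub> \<and>
               \<not> crosses_identity (dihedral m) ws}"
proof -
  interpret D: dihedral_rep m \<rho>
    using assms(1,2) by unfold_locales auto
  interpret X: free_generators X "tensor_invariants (dihedral m) \<rho>"
    using assms(3) by unfold_locales
  let ?S = "{dihedral_r m, dihedral_s m}"
  have S: "?S \<subseteq> carrier (dihedral m)" "finite ?S"
    using D.r_closed D.s_closed by auto
  have words: "finite (words_of_degree X n) \<and> card (words_of_degree X n) = card (closed_words (dihedral m) ?S n)" for n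
  proof (cases "n = 0")
    case True
    then show ?thesis by (simp add: X.words_of_degree_0 D.closed_words_0)
  next
    case False
    then have n: "n \<ge> 1" by simp
    have "span (prod_list ` words_of_degree X n) = span (re_tensor D.\<kappa> ` half_words m n)"
      by (simp only: X.span_words D.span_re_tensor[OF n])
    then obtain f where "bij_betw f (prod_list ` words_of_degree X n) (re_tensor D.\<kappa> ` half_words m n)"
      using bij_if_span_eq_span_bases[OF X.independent_words D.independent_re_tensor[OF n]] by blast
    then have "finite (prod_list ` words_of_degree X n)"
      and "card (prod_list ` words_of_degree X n) = card (re_tensor D.\<kappa> ` half_words m n)"
      using finite_half_words bij_betw_finite bij_betw_same_card by blast+
    moreover have "inj_on prod_list (words_of_degree X n)"
      by (rule inj_on_subset[OF X.inj_prod_list]) (auto simp: words_of_degree_def)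
    ultimately show ?thesis
      using D.inj_re_tensor[OF n]
      by (simp add: D.card_closed_words_eq_half_words[OF n] card_image finite_image_iff)
  qed
  have "card {x \<in> X. x \<in> tensor_power d} = card (first_return_words (dihedral m) ?S d)"
  proof (rule renewal_unique[where a = "\<lambda>n. card (words_of_degree X n)"
        and x = "\<lambda>k. card {x \<in> X. x \<in> tensor_power k}"
        and y = "\<lambda>k. card (first_return_words (dihedral m) ?S k)"])
    show "card (words_of_degree X n) = (\<Sum>k=1..n. card {x \<in> X. x \<in> tensor_power k} * card (words_of_degree X (n - k)))"
      if "n \<ge> 1" for n
      using X.card_words_of_degree that words by blast
    show "card (words_of_degree X n) = (\<Sum>k=1..n. card (first_return_words (dihedral m) ?S k) * card (words_of_degree X (n - k)))"
      if "n \<ge> 1" for n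
      using D.card_closed_words[OF S that] words by simp
  qed (use assms(4) in \<open>simp_all add: X.words_of_degree_0\<close>)
  moreover have "finite {x \<in> X. x \<in> tensor_power d}"
    using X.finite_generators words by blast
  ultimately show ?thesis
    by (simp add: first_return_words_def)
qed

end
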